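(* Let $p$ be a prime with $p\equiv 1\pmod 3$ such that $2$ is a cubic residue modulo $p$. Then the spectrum of $\Gamma(3,p^3)$ determines the spectrum of $\Gamma(3,p^{3\ell})$ for every $\ell\in\mathbb{N}$. Explicitly, let $x_0,y_0$ be integers with $p=x_0^2+27y_0^2$, $\gcd(x_0,p)=1$ and $x_0\equiv 1\pmod 3$, and for $\ell\in\mathbb{N}$ put $n_\ell=\frac{p^{3\ell}-1}{3}$, $$a_\ell=-(x_0+3\sqrt3 y_0 i)^\ell-(x_0-3\sqrt3 y_0 i)^\ell,$$ $$b_\ell=-\big(y_0-\tfrac{\sqrt3}{9}x_0 i\big)(x_0+3\sqrt3y_0 i)^{\ell-1}-\big(y_0+\tfrac{\sqrt3}{9}x_0 i\big)(x_0-3\sqrt3 y_0 i)^{\ell-1}.$$ Then the eigenvalues of $\Gamma(3,p^{3\ell})$, listed with multiplicity, are $n_\ell$ once and each of $$\tfrac{a_\ell p^\ell-1}{3},\qquad \tfrac{-\frac12(a_\ell+9b_\ell)p^\ell-1}{3},\qquad \tfrac{-\frac12(a_\ell-9b_\ell)p^\ell-1}{3}$$ with multiplicity $n_\ell$.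
   Context: For a prime power $q$ and $k\mid q-1$, let $R_k=\{x^k : x\in\mathbb{F}_q^*\}$. The generalized Paley graph $\Gamma(k,q)$ is the Cayley graph on $\mathbb{F}_q$ in which $v,w$ are adjacent iff $w-v\in R_k$; its eigenvalues are those of its adjacency matrix. An integer $a$ is a cubic residue modulo $p$ if $a\equiv x^3\pmod p$ for some integer $x$. *)

theory Defs
  imports
    "HOL-Analysis.Analysis"
    "HOL-Computational_Algebra.Computational_Algebra"
    "HOL-Number_Theory.Number_Theory"
    "Graph_Theory.Pair_Digraph"
begin

definition cayley_digraph :: "'a::group_add set \<Rightarrow> 'a pair_pre_digraph" where
  "cayley_digraph S = \<lparr> pverts = UNIV, parcs = {(v, w). w - v \<in> S} \<rparr>"

definition power_residues :: "nat \<Rightarrow> 'a::field set" where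
  "power_residues k = {x ^ k | x. x \<noteq> 0}"

text \<open>
  The field with \<open>q\<close> elements is represented by a finite type of class \<open>field\<close> with
  \<open>q\<close> elements; it is the vertex type of the graph.
\<close>

definition generalized_paley :: "nat \<Rightarrow> 'a::{field,finite} itself \<Rightarrow> 'a pair_pre_digraph" where
  "generalized_paley k _ = cayley_digraph (power_residues k)"

text \<open>
  The adjacency matrix is indexed by the whole vertex type, so it is meant for graphs \<open>G\<close> with
  \<open>pverts G = UNIV\<close>, such as Cayley graphs.
\<close>

definition adjacency_matrix :: "'a::finite pair_pre_digraph \<Rightarrow> complex ^ 'a ^ 'a" where
  "adjacency_matrix G = (\<chi> v w. if (v, w) \<in> parcs G then 1 else 0)"

definition charpoly :: "complex ^ 'n ^ 'n \<Rightarrow> complex poly" where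
  "charpoly A = det (\<chi> i j. (if i = j then [:0, 1:] else 0) - [:A $ i $ j:])"

text \<open>
  Eigenvalues are listed with their algebraic multiplicity.
\<close>

definition graph_spectrum :: "'a::finite pair_pre_digraph \<Rightarrow> complex multiset" where
  "graph_spectrum G = proots (charpoly (adjacency_matrix G))"

definition cubic_residue :: "nat \<Rightarrow> int \<Rightarrow> bool" where
  "cubic_residue p a \<longleftrightarrow> (\<exists>x::int. [a = x ^ 3] (mod int p))"

definition cubic_representation :: "nat \<Rightarrow> int \<Rightarrow> int \<Rightarrow> bool" where
  "cubic_representation p x y \<longleftrightarrow>
     int p = x\<^sup>2 + 27 * y\<^sup>2 \<and> gcd x (int p) = 1 \<and> [x = 1] (mod 3)"

definition n_coeff :: "nat \<Rightarrow> nat \<Rightarrow> nat" where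
  "n_coeff p l = (p ^ (3 * l) - 1) div 3"

definition a_coeff :: "int \<Rightarrow> int \<Rightarrow> nat \<Rightarrow> complex" where
  "a_coeff x y l =
     - ((of_int x + 3 * of_real (sqrt 3) * of_int y * \<i>) ^ l)
     - (of_int x - 3 * of_real (sqrt 3) * of_int y * \<i>) ^ l"

text \<open>
  Only used for \<open>l \<ge> 1\<close>, so the subtraction \<open>l - 1\<close> is never truncated.
\<close>

definition b_coeff :: "int \<Rightarrow> int \<Rightarrow> nat \<Rightarrow> complex" where
  "b_coeff x y l =
     - (of_int y - of_real (sqrt 3) / 9 * of_int x * \<i>)
         * (of_int x + 3 * of_real (sqrt 3) * of_int y * \<i>) ^ (l - 1)
     - (of_int y + of_real (sqrt 3) / 9 * of_int x * \<i>)
         * (of_int x - 3 * of_real (sqrt 3) * of_int y * \<i>) ^ (l - 1)"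

end

theory Submission
  imports Defs
begin

text \<open>
  An additive character of the field diagonalises the adjacency matrix. With \<open>G\<close>, \<open>G'\<close> the Gauss sums
  of the two nontrivial cubic characters, the nontrivial eigenvalues \<open>\<lambda>\<close> satisfy
  \<open>3 \<lambda> + 1 = \<omega>\<^sup>2 G + \<omega> G'\<close>, where \<open>\<omega>\<close> runs through the cube roots of unity. They are therefore
  determined by \<open>G G' = q\<close> and \<open>G\<^sup>3 + G'\<^sup>3 = q c\<close>, where \<open>c = J + J'\<close> is the trace of a Jacobi sum.
  One has \<open>4 q = c\<^sup>2 + 27 d\<^sup>2\<close> and \<open>c \<equiv> 1\<close> modulo 3, and, modulo \<open>p\<close>, \<open>c\<close> is minus the central binomial
  coefficient of \<open>(q - 1) / 3\<close>, which is prime to \<open>p\<close>. For \<open>q = p ^ (3 l)\<close> these conditions force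
  \<open>c = - z ^ (3 l) - z' ^ (3 l)\<close> with \<open>z, z' = x\<^sub>0 \<plusminus> 3 \<surd>3 y\<^sub>0 \<i>\<close>, so the Hasse--Davenport theorem is not needed.
  The representation \<open>p = x\<^sub>0\<^sup>2 + 27 y\<^sub>0\<^sup>2\<close> comes from \<open>4 p = c\<^sup>2 + 27 d\<^sup>2\<close>: here \<open>c = 9 K + 8 - p\<close> with
  \<open>K\<close> the number of \<open>x\<close> such that \<open>x\<close> and \<open>1 - x\<close> are nonzero cubes. If 2 is a cube, the involution \<open>x \<mapsto> 1 - x\<close>
  of this set has the single fixed point 1/2, so \<open>K\<close> is odd and \<open>c\<close> is even.
\<close>

section \<open>Cubic characters of residue fields\<close>

definition cubic_root :: complex where
  "cubic_root = Complex (- 1 / 2) (sqrt 3 / 2)"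

lemma cubic_root_square: "cubic_root\<^sup>2 = - 1 - cubic_root"
  by (simp add: cubic_root_def complex_eq_iff power2_eq_square field_simps)

lemma cubic_root_cube: "cubic_root ^ 3 = 1"
proof -
  have "cubic_root ^ 3 - 1 = (cubic_root - 1) * (cubic_root\<^sup>2 + 1 + cubic_root)"
    by (simp add: algebra_simps power2_eq_square power3_eq_cube)
  thus ?thesis
    by (simp add: cubic_root_square)
qed

lemma cubic_root_neq_1: "cubic_root \<noteq> 1"
  by (simp add: cubic_root_def complex_eq_iff)

lemma cubic_root_minus_square: "cubic_root - cubic_root\<^sup>2 = of_real (sqrt 3) * \<i>"
  unfolding cubic_root_square by (simp add: cubic_root_def complex_eq_iff)

text \<open>
  \<open>S\<close> is a set of representatives of the finite field \<open>R / I\<close>. The case \<open>R = \<int>\<close> is needed because there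
  is no type with \<open>p\<close> elements for a variable \<open>p\<close>.
\<close>

locale residue_field =
  fixes S I :: "'a :: comm_ring_1 set"
  assumes finite_S: "finite S"
    and zero_S: "0 \<in> S" and one_S: "1 \<in> S"
    and S_exists: "\<And>x. \<exists>y\<in>S. x - y \<in> I"
    and S_unique: "\<And>x y. x \<in> S \<Longrightarrow> y \<in> S \<Longrightarrow> x - y \<in> I \<Longrightarrow> x = y"
    and I_add: "\<And>x y. x \<in> I \<Longrightarrow> y \<in> I \<Longrightarrow> x + y \<in> I"
    and I_mult: "\<And>x y. y \<in> I \<Longrightarrow> x * y \<in> I"
    and I_prime: "\<And>x y. x * y \<in> I \<Longrightarrow> x \<in> I \<or> y \<in> I"
    and one_notin_I: "1 \<notin> I"
begin

text \<open>Functions on the quotient by \<open>I\<close> are kept as functions on the whole ring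
  that are constant on cosets.\<close>

definition periodic :: "('a \<Rightarrow> complex) \<Rightarrow> bool" where
  "periodic f \<longleftrightarrow> (\<forall>x y. x - y \<in> I \<longrightarrow> f x = f y)"

lemma periodicD: "periodic f \<Longrightarrow> x - y \<in> I \<Longrightarrow> f x = f y"
  by (auto simp: periodic_def)

lemma zero_I: "0 \<in> I"
  using S_exists[of 0] I_mult[of _ 0] by force

lemma I_uminus: "x \<in> I \<Longrightarrow> - x \<in> I"
  using I_mult[of x "-1"] by simp

lemma I_diff: "x \<in> I \<Longrightarrow> y \<in> I \<Longrightarrow> x - y \<in> I"
  using I_add[of x "-y"] I_uminus[of y] by simp

lemma I_commute: "x - y \<in> I \<longleftrightarrow> y - x \<in> I"
  using I_uminus[of "x - y"] I_uminus[of "y - x"] by auto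

lemma I_trans: "x - y \<in> I \<Longrightarrow> y - z \<in> I \<Longrightarrow> x - z \<in> I"
  using I_add[of "x - y" "y - z"] by simp

lemma I_mult_iff: "x * y \<in> I \<longleftrightarrow> x \<in> I \<or> y \<in> I"
  using I_prime I_mult by (metis mult.commute)

lemma I_power_iff: "n > 0 \<Longrightarrow> x ^ n \<in> I \<longleftrightarrow> x \<in> I"
proof (induction n rule: nat_induct_non_zero)
  case (Suc n)
  thus ?case
    by (simp add: I_mult_iff)
qed simp

lemma cong_mult: "x - y \<in> I \<Longrightarrow> u - v \<in> I \<Longrightarrow> x * u - y * v \<in> I"
  using I_add[of "u * (x - y)" "y * (u - v)"] I_mult[of "x - y" u] I_mult[of "u - v" y]
  by (simp add: algebra_simps)

lemma cong_power: "x - y \<in> I \<Longrightarrow> x ^ n - y ^ n \<in> I"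
  by (induction n) (auto simp: zero_I intro: cong_mult)

lemma cong_I_iff: "x - y \<in> I \<Longrightarrow> x \<in> I \<longleftrightarrow> y \<in> I"
  using I_add[of "x - y" y] I_diff[of x "x - y"] by auto

lemma S_I_iff: "x \<in> S \<Longrightarrow> x \<in> I \<longleftrightarrow> x = 0"
  using S_unique[of x 0] zero_S zero_I by auto

definition reduce :: "'a \<Rightarrow> 'a" where
  "reduce x = (SOME y. y \<in> S \<and> x - y \<in> I)"

lemma reduce: "reduce x \<in> S" "x - reduce x \<in> I"
  using someI_ex[of "\<lambda>y. y \<in> S \<and> x - y \<in> I"] S_exists[of x] unfolding reduce_def by auto

text \<open>Since \<open>g\<close> is injective modulo \<open>I\<close>, reducing its values
  permutes the finite set \<open>S\<close>, and a periodic \<open>f\<close> does not see the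
  reduction. Shifts, reflections and dilations of character sums are all instances.\<close>

lemma sum_reindex:
  assumes "periodic f" and "\<And>x y. x \<in> S \<Longrightarrow> y \<in> S \<Longrightarrow> g x - g y \<in> I \<Longrightarrow> x - y \<in> I"
  shows "(\<Sum>x\<in>S. f (g x)) = (\<Sum>x\<in>S. f x)"
proof -
  have inj: "inj_on (\<lambda>x. reduce (g x)) S"
  proof (rule inj_onI)
    fix x y assume xy: "x \<in> S" "y \<in> S" "reduce (g x) = reduce (g y)"
    have "g x - g y \<in> I"
      using I_trans[OF reduce(2)[of "g x"], of "g y"] reduce(2)[of "g y"] xy(3)
        I_commute[of "g y"] by simp
    thus "x = y"
      using assms(2) S_unique xy by blast
  qed
  have img: "(\<lambda>x. reduce (g x)) ` S = S"
    by (rule card_subset_eq) (auto simp: finite_S reduce card_image inj)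
  have "(\<Sum>x\<in>S. f (g x)) = (\<Sum>x\<in>S. f (reduce (g x)))"
    by (intro sum.cong refl periodicD[OF assms(1)] reduce)
  also have "\<dots> = (\<Sum>x\<in>(\<lambda>x. reduce (g x)) ` S. f x)"
    by (simp add: sum.reindex inj)
  finally show ?thesis
    by (simp add: img)
qed

lemma sum_shift: "periodic f \<Longrightarrow> (\<Sum>x\<in>S. f (x + a)) = (\<Sum>x\<in>S. f x)"
  by (rule sum_reindex) auto

lemma sum_reflect: "periodic f \<Longrightarrow> (\<Sum>x\<in>S. f (a - x)) = (\<Sum>x\<in>S. f x)"
  by (rule sum_reindex) (auto simp: I_commute)

lemma sum_scale: "periodic f \<Longrightarrow> a \<notin> I \<Longrightarrow> (\<Sum>x\<in>S. f (a * x)) = (\<Sum>x\<in>S. f x)"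
  by (rule sum_reindex) (auto simp: I_mult_iff simp flip: right_diff_distrib)

lemma sum_scale':
  assumes "periodic f" "a \<notin> I"
  shows "(\<Sum>x\<in>S-{0}. f (a * x)) = (\<Sum>x\<in>S-{0}. f x)"
  using sum_scale[OF assms] finite_S zero_S by (simp add: sum.remove)

end

text \<open>Here \<open>3 * m\<close> takes the place of the order of the unit group. The element
  \<open>nr\<close> is a cubic nonresidue; it makes \<open>nr ^ m\<close> a primitive cube root of
  unity modulo \<open>I\<close> and so fixes one of the two nontrivial cubic characters.\<close>

locale cubic_residue_field = residue_field +
  fixes m :: nat and nr :: 'a
  assumes m_pos: "m > 0"
    and Fermat: "\<And>x. x \<notin> I \<Longrightarrow> x ^ (3 * m) - 1 \<in> I"
    and nonresidue: "nr \<notin> I" "nr ^ m - 1 \<notin> I"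
begin

abbreviation w :: 'a where "w \<equiv> nr ^ m"

text \<open>The cubic residue symbol: \<open>x ^ m\<close> is congruent to a power of
  \<open>w\<close>, and \<open>w\<close> is sent to \<open>cubic_root\<close>. The last branch is
  the case of \<open>w\<^sup>2\<close>, the only one left by \<open>power_m_cases\<close>.\<close>

definition chi :: "'a \<Rightarrow> complex" where
  "chi x = (if x \<in> I then 0 else if x ^ m - 1 \<in> I then 1 else if x ^ m - w \<in> I then cubic_root
     else cubic_root\<^sup>2)"

lemma w_cube: "w ^ 3 - 1 \<in> I"
  using Fermat[OF nonresidue(1)] by (simp add: mult.commute flip: power_mult)

lemma w_notin_I: "w \<notin> I"
  using nonresidue m_pos by (simp add: I_power_iff)

lemma w_square_cong: "w\<^sup>2 - 1 \<notin> I" "w\<^sup>2 - w \<notin> I"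
proof -
  show *: "w\<^sup>2 - w \<notin> I"
  proof
    assume "w\<^sup>2 - w \<in> I"
    hence "w * (w - 1) \<in> I"
      by (simp add: algebra_simps power2_eq_square)
    thus False
      using w_notin_I nonresidue by (auto simp: I_mult_iff)
  qed
  show "w\<^sup>2 - 1 \<notin> I"
  proof
    assume "w\<^sup>2 - 1 \<in> I"
    hence "w * w\<^sup>2 - w * 1 \<in> I"
      by (intro cong_mult) (auto simp: zero_I)
    hence "w ^ 3 - w \<in> I"
      by (simp add: power2_eq_square power3_eq_cube mult.assoc)
    hence "w - 1 \<in> I"
      using w_cube I_trans I_commute by blast
    thus False
      using nonresidue by simp
  qed
qed

lemma power_m_cases:
  assumes "x \<notin> I"
  obtains i where "i < 3" "x ^ m - w ^ i \<in> I"
proof -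
  let ?y = "x ^ m"
  have *: "?y ^ 3 - 1 \<in> I"
    using Fermat[OF assms] by (simp add: mult.commute flip: power_mult)
  have "(w - 1) * (w\<^sup>2 + w + 1) \<in> I"
    using w_cube by (simp add: algebra_simps power2_eq_square power3_eq_cube)
  hence s: "w\<^sup>2 + w + 1 \<in> I"
    using nonresidue by (auto simp: I_mult_iff)
  \<comment> \<open>The product of the three candidates differs from \<open>?y ^ 3 - w ^ 3\<close>
    by a multiple of \<open>w\<^sup>2 + w + 1\<close>, which lies in \<open>I\<close>; primality of
    \<open>I\<close> then selects a factor.\<close>
  have "(?y - 1) * (?y - w) * (?y - w\<^sup>2) = (?y ^ 3 - 1) - (w ^ 3 - 1)
          + (w\<^sup>2 + w + 1) * (w * ?y - ?y\<^sup>2)"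
    by (simp add: algebra_simps power2_eq_square power3_eq_cube)
  also have "\<dots> \<in> I"
    by (intro I_add I_diff * w_cube) (simp add: I_mult_iff s)
  finally have "?y - 1 \<in> I \<or> ?y - w \<in> I \<or> ?y - w\<^sup>2 \<in> I"
    by (simp add: I_mult_iff)
  thus ?thesis
    using that[of 0] that[of 1] that[of 2] by auto
qed

text \<open>Both sides depend on \<open>i\<close> modulo 3 only, and 1, \<open>w\<close>,
  \<open>w\<^sup>2\<close> are incongruent, so a single branch of \<open>chi\<close> applies.
  Exponents beyond 2 are allowed so that they can be added in \<open>chi_mult\<close>.\<close>

lemma chi_eq:
  assumes "x \<notin> I" "x ^ m - w ^ i \<in> I"
  shows "chi x = cubic_root ^ i"
proof -
  define j where "j = i mod 3"
  have "i = 3 * (i div 3) + j"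
    by (simp add: j_def)
  hence wi: "w ^ i = (w ^ 3) ^ (i div 3) * w ^ j" and ci: "cubic_root ^ i = cubic_root ^ j"
    by (metis power_add power_mult) (metis \<open>i = _\<close> power_add power_mult cubic_root_cube power_one mult_1)
  have "(w ^ 3) ^ (i div 3) * w ^ j - 1 ^ (i div 3) * w ^ j \<in> I"
    by (intro cong_mult cong_power w_cube) (simp add: zero_I)
  hence "x ^ m - w ^ j \<in> I"
    using assms(2) I_trans unfolding wi by fastforce
  hence wj: "x ^ m - w ^ j \<in> I" .
  have *: "w ^ j - z \<in> I" if "x ^ m - z \<in> I" for z
    using I_trans[OF _ that] wj I_commute by blast
  have "j = 0 \<or> j = 1 \<or> j = 2"
    by (auto simp: j_def)
  thus ?thesis
  proof (elim disjE)
    assume "j = 0"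
    thus ?thesis
      using wj assms(1) by (simp add: ci chi_def)
  next
    assume "j = 1"
    thus ?thesis
      using wj assms(1) *[of 1] nonresidue by (auto simp: ci chi_def)
  next
    assume "j = 2"
    thus ?thesis
      using assms(1) *[of 1] *[of w] w_square_cong by (auto simp: ci chi_def)
  qed
qed

lemma chi_cases:
  assumes "x \<notin> I"
  obtains i where "i < 3" "chi x = cubic_root ^ i"
  using power_m_cases[OF assms] chi_eq[OF assms] by metis

lemma chi_periodic: "periodic chi"
  unfolding periodic_def
proof (intro allI impI)
  fix x y assume xy: "x - y \<in> I"
  show "chi x = chi y"
  proof (cases "y \<in> I")
    case True
    thus ?thesis
      using cong_I_iff[OF xy] by (simp add: chi_def)
  next
    case False
    then obtain i where i: "y ^ m - w ^ i \<in> I"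
      using power_m_cases by blast
    hence "x ^ m - w ^ i \<in> I"
      using cong_power[OF xy, of m] I_trans by blast
    thus ?thesis
      using chi_eq[OF False i] chi_eq[of x i] cong_I_iff[OF xy] False by simp
  qed
qed

lemma chi_mult: "chi (x * y) = chi x * chi y"
proof (cases "x \<in> I \<or> y \<in> I")
  case True
  thus ?thesis
    by (auto simp: chi_def I_mult_iff)
next
  case False
  then obtain i j where ij: "x ^ m - w ^ i \<in> I" "y ^ m - w ^ j \<in> I"
    using power_m_cases by metis
  hence "(x * y) ^ m - w ^ (i + j) \<in> I"
    by (simp add: power_mult_distrib power_add cong_mult)
  hence "chi (x * y) = cubic_root ^ (i + j)"
    using False by (intro chi_eq) (auto simp: I_mult_iff)
  thus ?thesis
    using False ij chi_eq[of x i] chi_eq[of y j] by (simp add: power_add)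
qed

lemma chi_cube: "x \<notin> I \<Longrightarrow> chi x ^ 3 = 1"
proof -
  assume "x \<notin> I"
  then obtain i where "chi x = cubic_root ^ i"
    using chi_cases by blast
  hence "chi x ^ 3 = (cubic_root ^ 3) ^ i"
    by (simp add: mult.commute flip: power_mult)
  thus ?thesis
    by (simp add: cubic_root_cube)
qed

lemma chi_I: "x \<in> I \<Longrightarrow> chi x = 0"
  by (simp add: chi_def)

lemma chi_eq_0_iff: "chi x = 0 \<longleftrightarrow> x \<in> I"
  using chi_cube[of x] chi_I[of x] by force

lemma chi_eq_1_iff: "chi x = 1 \<longleftrightarrow> x \<notin> I \<and> x ^ m - 1 \<in> I"
proof -
  have "cubic_root\<^sup>2 \<noteq> 1"
    using cubic_root_neq_1 cubic_root_cube by (auto simp: power2_eq_square power3_eq_cube)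
  thus ?thesis
    using cubic_root_neq_1 by (auto simp: chi_def)
qed

lemma chi_one: "chi 1 = 1"
  by (simp add: chi_eq_1_iff one_notin_I zero_I)

lemma chi_minus_one: "chi (- 1) = 1"
proof -
  have "chi (- 1) ^ 2 = 1"
    by (simp add: power2_eq_square chi_one flip: chi_mult)
  moreover have "chi (- 1) ^ 3 = 1"
    using one_notin_I I_uminus[of "-1"] by (intro chi_cube) auto
  ultimately show ?thesis
    by (simp add: power3_eq_cube power2_eq_square)
qed

lemma chi_nr: "chi nr = cubic_root"
  using chi_eq[OF nonresidue(1), of 1] by (simp add: zero_I)

end

section \<open>Gauss and Jacobi sums\<close>

text \<open>\<open>psi\<close> is a nontrivial additive character of the quotient. It stays a
  parameter because the theory is instantiated both for the integers modulo a prime and for a finite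
  field.\<close>

locale gauss_sums = cubic_residue_field +
  fixes psi :: "'a \<Rightarrow> complex"
  assumes psi_add: "\<And>x y. psi (x + y) = psi x * psi y"
    and psi_I: "\<And>x. x \<in> I \<Longrightarrow> psi x = 1"
    and psi_nontrivial: "\<exists>x. psi x \<noteq> 1"
begin

lemma periodic_compose:
  "periodic f \<Longrightarrow> (\<And>x y. x - y \<in> I \<Longrightarrow> g x - g y \<in> I) \<Longrightarrow> periodic (\<lambda>x. f (g x))"
  by (simp add: periodic_def)

lemma periodic_mult: "periodic f \<Longrightarrow> periodic g \<Longrightarrow> periodic (\<lambda>x. f x * g x)"
  by (simp add: periodic_def)

lemma psi_periodic: "periodic psi"
  unfolding periodic_def
proof (intro allI impI)
  fix x y assume "x - y \<in> I"
  thus "psi x = psi y"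
    using psi_add[of "x - y" y] by (simp add: psi_I)
qed

lemma psi_zero: "psi 0 = 1"
  by (simp add: psi_I zero_I)

lemma sum_psi: "(\<Sum>x\<in>S. psi x) = 0"
proof -
  obtain a where a: "psi a \<noteq> 1"
    using psi_nontrivial by blast
  have "(\<Sum>x\<in>S. psi x) * psi a = (\<Sum>x\<in>S. psi x)"
    using sum_shift[OF psi_periodic, of a] by (simp add: psi_add sum_distrib_right)
  thus ?thesis
    using a by simp
qed

lemma sum_psi_mult: "(\<Sum>x\<in>S. psi (a * x)) = (if a \<in> I then of_nat (card S) else 0)"
  using sum_scale[OF psi_periodic, of a]
  by (auto simp: sum_psi psi_I I_mult_iff)

text \<open>The other nontrivial cubic character, which is the complex conjugate and, on units, the
  inverse of \<open>chi\<close>.\<close>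

definition chi2 :: "'a \<Rightarrow> complex" where
  "chi2 x = (chi x)\<^sup>2"

lemma chi2_periodic: "periodic chi2"
  using chi_periodic by (simp add: periodic_def chi2_def)

lemma chi2_mult: "chi2 (x * y) = chi2 x * chi2 y"
  by (simp add: chi2_def chi_mult power_mult_distrib)

lemma chi_chi2: "chi x * chi2 x = (if x \<in> I then 0 else 1)"
  using chi_cube[of x] by (auto simp: chi2_def chi_I power2_eq_square power3_eq_cube mult.assoc)

lemma chi2_square: "chi2 x * chi2 x = chi x"
  using chi_cube[of x]
  by (cases "x \<in> I") (simp_all add: chi2_def chi_I power2_eq_square power3_eq_cube mult.assoc)

lemma chi2_I: "x \<in> I \<Longrightarrow> chi2 x = 0"
  by (simp add: chi2_def chi_I)

lemma chi2_one: "chi2 1 = 1" and chi2_minus_one: "chi2 (- 1) = 1"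
  by (simp_all add: chi2_def chi_one chi_minus_one)

text \<open>Replacing \<open>x\<close> by \<open>a * x\<close> permutes the summands and multiplies
  the sum by \<open>f a\<close>, which is not 1.\<close>

lemma sum_mult_eq_0:
  assumes "periodic f" "\<And>x y. f (x * y) = f x * f y" "f a \<noteq> 1" "a \<notin> I"
  shows "(\<Sum>x\<in>S. f x) = 0"
  using sum_scale[OF assms(1,4)] assms by (simp flip: sum_distrib_left)

lemma sum_chi: "(\<Sum>x\<in>S. chi x) = 0"
  using sum_mult_eq_0[OF chi_periodic chi_mult _ nonresidue(1)] chi_nr cubic_root_neq_1 by simp

lemma sum_chi2: "(\<Sum>x\<in>S. chi2 x) = 0"
proof (rule sum_mult_eq_0[OF chi2_periodic chi2_mult _ nonresidue(1)])
  show "chi2 nr \<noteq> 1"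
    using cubic_root_neq_1 chi2_square[of nr] by (auto simp: chi_nr)
qed

definition gauss :: "('a \<Rightarrow> complex) \<Rightarrow> complex" where
  "gauss f = (\<Sum>x\<in>S. f x * psi x)"

definition jacobi :: "('a \<Rightarrow> complex) \<Rightarrow> ('a \<Rightarrow> complex) \<Rightarrow> complex" where
  "jacobi f g = (\<Sum>x\<in>S. f x * g (1 - x))"

text \<open>The double sum is grouped by \<open>s = x + y\<close>. The terms with
  \<open>s = 0\<close> give the first summand; for the others the dilation of \<open>x\<close> by
  \<open>s\<close> extracts \<open>f s * g s\<close> and leaves a Jacobi sum. The formula serves for
  a nontrivial as well as for a trivial product of the two characters.\<close>

lemma gauss_mult:
  assumes f: "periodic f" "\<And>x y. f (x * y) = f x * f y"
    and g: "periodic g" "\<And>x y. g (x * y) = g x * g y"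
  shows "gauss f * gauss g =
    g (- 1) * (\<Sum>x\<in>S. f x * g x) + jacobi f g * (\<Sum>s\<in>S - {0}. f s * g s * psi s)"
proof -
  have conv: "(\<Sum>x\<in>S. f x * g (s - x)) = f s * g s * jacobi f g" if "s \<in> S - {0}" for s
  proof -
    have "s \<notin> I"
      using that S_I_iff by auto
    have "(\<Sum>x\<in>S. f x * g (s - x)) = (\<Sum>x\<in>S. f (s * x) * g (s - s * x))"
      by (rule sum_scale[OF _ \<open>s \<notin> I\<close>, symmetric])
         (intro periodic_mult f periodic_compose[OF g(1)]; simp add: I_commute)
    also have "\<dots> = (\<Sum>x\<in>S. f s * g s * (f x * g (1 - x)))"
    proof (rule sum.cong[OF refl])
      fix x
      have "g (s - s * x) = g s * g (1 - x)"
        by (simp add: algebra_simps flip: g(2))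
      thus "f (s * x) * g (s - s * x) = f s * g s * (f x * g (1 - x))"
        by (simp add: f(2))
    qed
    finally show ?thesis
      by (simp add: jacobi_def sum_distrib_left)
  qed
  have "gauss f * gauss g = (\<Sum>x\<in>S. \<Sum>y\<in>S. f x * g y * psi (x + y))"
    by (simp add: gauss_def sum_product psi_add mult_ac)
  also have "\<dots> = (\<Sum>x\<in>S. \<Sum>s\<in>S. f x * g (s - x) * psi s)"
  proof (rule sum.cong[OF refl])
    fix x
    have "periodic (\<lambda>y. f x * g y * psi (x + y))"
      using g(1) psi_periodic by (simp add: periodic_def)
    from sum_shift[OF this, of "- x"]
    show "(\<Sum>y\<in>S. f x * g y * psi (x + y)) = (\<Sum>s\<in>S. f x * g (s - x) * psi s)"
      by simp
  qed
  also have "\<dots> = (\<Sum>s\<in>S. psi s * (\<Sum>x\<in>S. f x * g (s - x)))"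
    by (subst sum.swap) (simp add: sum_distrib_left mult_ac)
  also have "\<dots> = (\<Sum>x\<in>S. f x * g (- x)) + (\<Sum>s\<in>S - {0}. psi s * (\<Sum>x\<in>S. f x * g (s - x)))"
    using finite_S zero_S by (subst sum.remove[of _ 0]) (auto simp: psi_zero)
  also have "(\<Sum>s\<in>S - {0}. psi s * (\<Sum>x\<in>S. f x * g (s - x)))
      = jacobi f g * (\<Sum>s\<in>S - {0}. f s * g s * psi s)"
  proof -
    have "psi s * (\<Sum>x\<in>S. f x * g (s - x)) = jacobi f g * (f s * g s * psi s)" if "s \<in> S - {0}" for s
      unfolding conv[OF that] by (simp add: mult_ac)
    thus ?thesis
      unfolding sum_distrib_left[of "jacobi f g"] by (rule sum.cong[OF refl])
  qed
  also have "(\<Sum>x\<in>S. f x * g (- x)) = g (- 1) * (\<Sum>x\<in>S. f x * g x)"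
  proof -
    have "g (- x) = g (- 1) * g x" for x
      using g(2)[of "- 1" x] by simp
    thus ?thesis
      unfolding sum_distrib_left by (intro sum.cong refl) (metis mult.left_commute)
  qed
  finally show ?thesis .
qed

lemma gauss_minus_zero:
  assumes "\<And>x. x \<in> I \<Longrightarrow> f x = 0"
  shows "(\<Sum>s\<in>S - {0}. f s * psi s) = gauss f"
  unfolding gauss_def using finite_S zero_S assms[OF zero_I] by (simp add: sum.remove)

abbreviation "G \<equiv> gauss chi"
abbreviation "G' \<equiv> gauss chi2"
abbreviation "J \<equiv> jacobi chi chi"
abbreviation "J' \<equiv> jacobi chi2 chi2"
abbreviation "q \<equiv> card S"

lemma G_square: "G * G = J * G'"
proof -
  have "chi x * chi x = chi2 x" for x
    by (simp add: chi2_def power2_eq_square)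
  thus ?thesis
    using gauss_mult[OF chi_periodic chi_mult chi_periodic chi_mult]
    by (simp add: sum_chi2 gauss_minus_zero chi2_I)
qed

lemma G'_square: "G' * G' = J' * G"
  using gauss_mult[OF chi2_periodic chi2_mult chi2_periodic chi2_mult]
  by (simp add: sum_chi gauss_minus_zero chi_I chi2_square)

text \<open>The dilation of \<open>x\<close> by \<open>y\<close> turns \<open>chi x * chi2 y\<close>
  into \<open>chi x\<close>. The sum of \<open>psi (y * (x + 1))\<close> over nonzero
  \<open>y\<close> is then \<open>q - 1\<close> or -1, so only the class of -1 contributes, with
  \<open>chi (- 1) = 1\<close>.\<close>

lemma G_G': "G * G' = of_nat q"
proof -
  have psi': "(\<Sum>y\<in>S - {0}. psi (y * a)) = (if a \<in> I then of_nat q else 0) - 1" for a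
    using sum_psi_mult[of a] finite_S zero_S
    by (simp add: sum.remove psi_zero mult.commute eq_diff_eq add.commute)
  have "G * G' = (\<Sum>y\<in>S. \<Sum>x\<in>S. chi x * chi2 y * psi (x + y))"
    unfolding gauss_def sum_product by (subst sum.swap) (simp add: psi_add mult_ac)
  also have "\<dots> = (\<Sum>y\<in>S - {0}. \<Sum>x\<in>S. chi x * chi2 y * psi (x + y))"
    using finite_S zero_S by (subst sum.remove[of _ 0]) (auto simp: chi2_I zero_I)
  also have "\<dots> = (\<Sum>y\<in>S - {0}. \<Sum>x\<in>S. chi x * psi (y * (x + 1)))"
  proof (rule sum.cong[OF refl])
    fix y assume "y \<in> S - {0}"
    hence y: "y \<notin> I"
      using S_I_iff by auto
    have "periodic (\<lambda>x. chi x * chi2 y * psi (x + y))"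
      using chi_periodic psi_periodic by (simp add: periodic_def)
    from sum_scale[OF this y]
    have "(\<Sum>x\<in>S. chi x * chi2 y * psi (x + y)) = (\<Sum>x\<in>S. chi (y * x) * chi2 y * psi (y * x + y))"
      by simp
    also have "\<dots> = (\<Sum>x\<in>S. chi x * psi (y * (x + 1)))"
    proof (rule sum.cong[OF refl])
      fix x
      have "chi (y * x) * chi2 y = chi x"
        using chi_chi2[of y] y by (simp add: chi_mult mult_ac)
      thus "chi (y * x) * chi2 y * psi (y * x + y) = chi x * psi (y * (x + 1))"
        by (simp add: algebra_simps)
    qed
    finally show "(\<Sum>x\<in>S. chi x * chi2 y * psi (x + y)) = (\<Sum>x\<in>S. chi x * psi (y * (x + 1)))" .
  qed
  also have "\<dots> = (\<Sum>x\<in>S. chi x * (\<Sum>y\<in>S - {0}. psi (y * (x + 1))))"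
    by (subst sum.swap) (simp add: sum_distrib_left)
  also have "\<dots> = (\<Sum>x\<in>S. chi x * (if x + 1 \<in> I then of_nat q else 0)) - (\<Sum>x\<in>S. chi x)"
    unfolding psi' by (simp add: algebra_simps sum_subtractf)
  also have "(\<Sum>x\<in>S. chi x * (if x + 1 \<in> I then of_nat q else 0))
     = (\<Sum>x\<in>S. chi (x - 1) * (if x \<in> I then of_nat q else 0))"
  proof -
    have "periodic (\<lambda>x. chi x * (if x + 1 \<in> I then of_nat q else 0))"
      unfolding periodic_def
    proof (intro allI impI)
      fix x y assume "x - y \<in> I"
      thus "chi x * (if x + 1 \<in> I then of_nat q else 0) = chi y * (if y + 1 \<in> I then of_nat q else 0)"
        using periodicD[OF chi_periodic] cong_I_iff[of "x + 1" "y + 1"] by simp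
    qed
    from sum_shift[OF this, of "- 1"] show ?thesis
      by simp
  qed
  also have "\<dots> = of_nat q"
    using finite_S zero_S by (simp add: sum.remove[of _ 0] zero_I S_I_iff chi_minus_one)
  finally show ?thesis
    by (simp add: sum_chi)
qed

lemma card_S_pos: "q > 0"
  using finite_S zero_S by (auto simp: card_gt_0_iff)

lemma G_cube: "G ^ 3 = of_nat q * J"
proof -
  have "G ^ 3 = G * (G * G)"
    by (simp add: power3_eq_cube)
  also have "\<dots> = G * G' * J"
    unfolding G_square by simp
  finally show ?thesis
    by (simp add: G_G')
qed

lemma G'_cube: "G' ^ 3 = of_nat q * J'"
proof -
  have "G' ^ 3 = G' * (G' * G')"
    by (simp add: power3_eq_cube)
  also have "\<dots> = G * G' * J'"
    unfolding G'_square by simp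
  finally show ?thesis
    by (simp add: G_G')
qed

lemma J_J': "J * J' = of_nat q"
proof -
  have "of_nat q ^ 2 * (J * J') = G ^ 3 * G' ^ 3"
    by (simp add: G_cube G'_cube power2_eq_square)
  also have "\<dots> = of_nat q ^ 2 * of_nat q"
    unfolding power_mult_distrib[symmetric] G_G' by (simp add: power3_eq_cube power2_eq_square)
  finally show ?thesis
    using card_S_pos by simp
qed

text \<open>The product of the two characters is trivial, so \<open>gauss_mult\<close> reads
  \<open>q = (q - 1) - jacobi chi chi2\<close>. The second equation follows by reflecting
  \<open>x\<close> to \<open>1 - x\<close>.\<close>

lemma jacobi_chi_chi2: "jacobi chi chi2 = - 1" "jacobi chi2 chi = - 1"
proof -
  have "(\<Sum>s\<in>S - {0}. chi s * chi2 s * psi s) = (\<Sum>s\<in>S - {0}. psi s)"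
    by (intro sum.cong refl) (auto simp: chi_chi2 S_I_iff)
  also have "\<dots> = - 1"
    using sum_psi finite_S zero_S by (simp add: sum.remove psi_zero eq_neg_iff_add_eq_0 add.commute)
  finally have 1: "(\<Sum>s\<in>S - {0}. chi s * chi2 s * psi s) = - 1" .
  have "(\<Sum>s\<in>S. chi s * chi2 s) = (\<Sum>s\<in>S - {0}. 1)"
    using finite_S zero_S
    by (subst sum.remove[of _ 0]) (auto simp: chi_chi2 zero_I S_I_iff intro!: sum.cong)
  also have "\<dots> = of_nat q - 1"
    using finite_S zero_S card_S_pos by (simp add: of_nat_diff)
  finally have 2: "(\<Sum>s\<in>S. chi s * chi2 s) = of_nat q - 1" .
  show *: "jacobi chi chi2 = - 1"
    using gauss_mult[OF chi_periodic chi_mult chi2_periodic chi2_mult]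
    by (simp add: 1 2 G_G' chi2_minus_one)
  have "periodic (\<lambda>x. chi x * chi2 (1 - x))"
    by (intro periodic_mult chi_periodic periodic_compose[OF chi2_periodic]) (simp add: I_commute)
  from sum_reflect[OF this, of 1] show "jacobi chi2 chi = - 1"
    using * by (simp add: jacobi_def mult_ac)
qed

lemma sum_chi_reflect: "(\<Sum>x\<in>S. chi (1 - x)) = 0" "(\<Sum>x\<in>S. chi2 (1 - x)) = 0"
  using sum_reflect[OF chi_periodic, of 1] sum_reflect[OF chi2_periodic, of 1]
  by (simp_all add: sum_chi sum_chi2)

text \<open>On units this is three times the indicator of the kernel of \<open>chi\<close>; on
  \<open>I\<close> it takes the value 1.\<close>

definition indicator3 :: "'a \<Rightarrow> complex" where
  "indicator3 x = 1 + chi x + chi2 x"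

lemma indicator3_eq: "x \<notin> I \<Longrightarrow> indicator3 x = (if chi x = 1 then 3 else 0)"
proof -
  assume "x \<notin> I"
  hence "(chi x - 1) * indicator3 x = 0"
    using chi_cube[of x] by (simp add: indicator3_def chi2_def algebra_simps power2_eq_square power3_eq_cube)
  thus ?thesis
    by (auto simp: indicator3_def chi2_def)
qed

definition K :: nat where
  "K = card {x \<in> S - {0, 1}. chi x = 1 \<and> chi (1 - x) = 1}"

text \<open>The sum of \<open>indicator3 x * indicator3 (1 - x)\<close> is evaluated twice: by
  expanding it into character sums, and by counting.\<close>

lemma J_add_J': "J + J' = of_int (9 * int K + 8 - int q)"
proof -
  have "(\<Sum>x\<in>S. indicator3 x * indicator3 (1 - x)) = (\<Sum>x\<in>S. 1) + (\<Sum>x\<in>S. chi x) + (\<Sum>x\<in>S. chi2 x)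
          + (\<Sum>x\<in>S. chi (1 - x)) + (\<Sum>x\<in>S. chi2 (1 - x)) + J + J' + jacobi chi chi2 + jacobi chi2 chi"
    by (simp add: indicator3_def jacobi_def algebra_simps sum.distrib)
  also have "\<dots> = of_nat q + J + J' - 2"
    by (simp add: sum_chi_reflect sum_chi sum_chi2 jacobi_chi_chi2)
  finally have 1: "(\<Sum>x\<in>S. indicator3 x * indicator3 (1 - x)) = of_nat q + J + J' - 2" .
  \<comment> \<open>The points 0 and 1 contribute \<open>1 * 3\<close> and
    \<open>3 * 1\<close>.\<close>
  have "(\<Sum>x\<in>S. indicator3 x * indicator3 (1 - x))
      = 3 + 3 + (\<Sum>x\<in>S - {0} - {1}. indicator3 x * indicator3 (1 - x))"
    using finite_S zero_S one_S one_notin_I zero_I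
    by (subst sum.remove[of _ 0], simp, simp, subst sum.remove[of _ 1])
       (auto simp: indicator3_def chi_I chi2_I chi_one chi2_one)
  also have "(\<Sum>x\<in>S - {0} - {1}. indicator3 x * indicator3 (1 - x))
      = (\<Sum>x\<in>S - {0, 1}. if chi x = 1 \<and> chi (1 - x) = 1 then 9 else 0)"
  proof (rule sum.cong)
    fix x assume x: "x \<in> S - {0, 1}"
    hence "x \<notin> I" "1 - x \<notin> I"
      using S_I_iff S_unique[OF one_S] by auto
    thus "indicator3 x * indicator3 (1 - x) = (if chi x = 1 \<and> chi (1 - x) = 1 then 9 else 0)"
      by (simp add: indicator3_eq)
  qed auto
  also have "\<dots> = 9 * of_nat K"
    using finite_S by (simp add: K_def sum.If_cases Int_def)
  finally have "9 * of_nat K + 6 = of_nat q + J + J' - 2"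
    using 1 by simp
  thus ?thesis
    by (simp add: algebra_simps)
qed

text \<open>Termwise: \<open>J - J'\<close> is the sum of \<open>chi y - chi2 y\<close> at
  \<open>y = x * (1 - x)\<close>, and each such difference is 0 or plus or minus the square root of
  -3.\<close>

lemma J_diff_J': "\<exists>e::int. J - J' = of_int e * (of_real (sqrt 3) * \<i>)"
proof -
  have "\<exists>e::int. chi y - chi2 y = of_int e * (of_real (sqrt 3) * \<i>)" for y
  proof (cases "y \<in> I")
    case True
    thus ?thesis
      by (intro exI[of _ 0]) (simp add: chi_I chi2_I)
  next
    case False
    then obtain i where i: "i < 3" "chi y = cubic_root ^ i"
      using chi_cases by blast
    have "(cubic_root\<^sup>2)\<^sup>2 = cubic_root ^ 3 * cubic_root"
      by (simp add: power2_eq_square power3_eq_cube)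
    hence 4: "(cubic_root\<^sup>2)\<^sup>2 = cubic_root"
      by (simp add: cubic_root_cube)
    consider "i = 0" | "i = 1" | "i = 2"
      using i by linarith
    thus ?thesis
    proof cases
      case 1
      thus ?thesis
        by (intro exI[of _ 0]) (simp add: i chi2_def)
    next
      case 2
      thus ?thesis
        by (intro exI[of _ 1]) (simp add: i chi2_def cubic_root_minus_square)
    next
      case 3
      thus ?thesis
        by (intro exI[of _ "- 1"]) (simp only: i(2) chi2_def 4 flip: cubic_root_minus_square; simp)
    qed
  qed
  then obtain e :: "'a \<Rightarrow> int" where e: "\<And>y. chi y - chi2 y = of_int (e y) * (of_real (sqrt 3) * \<i>)"
    by metis
  have "J - J' = (\<Sum>x\<in>S. chi (x * (1 - x)) - chi2 (x * (1 - x)))"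
    by (simp add: jacobi_def sum_subtractf chi_mult chi2_mult)
  also have "\<dots> = of_int (\<Sum>x\<in>S. e (x * (1 - x))) * (of_real (sqrt 3) * \<i>)"
    unfolding e by (simp add: sum_distrib_right)
  finally show ?thesis
    by blast
qed

text \<open>The identity \<open>4 * (J * J') = (J + J')\<^sup>2 - (J - J')\<^sup>2\<close> gives the
  form with coefficient 3; a congruence modulo 9 then extracts a factor 3 from
  \<open>e\<close>.\<close>

lemma card_S_quadratic_form:
  assumes "[q = 1] (mod 3)"
  defines "c \<equiv> 9 * int K + 8 - int q"
  shows "\<exists>d::int. 4 * int q = c\<^sup>2 + 27 * d\<^sup>2"
proof -
  obtain e :: int where e: "J - J' = of_int e * (of_real (sqrt 3) * \<i>)"
    using J_diff_J' by blast
  have "of_int (4 * int q) = (4 * (J * J') :: complex)"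
    by (simp add: J_J')
  also have "\<dots> = (J + J')\<^sup>2 - (J - J')\<^sup>2"
    by (simp add: power2_eq_square algebra_simps)
  also have "\<dots> = of_int (c\<^sup>2 + 3 * e\<^sup>2)"
    unfolding e J_add_J' c_def by (simp add: power_mult_distrib flip: of_real_power)
  finally have eq: "4 * int q = c\<^sup>2 + 3 * e\<^sup>2"
    using of_int_eq_iff by blast
  define t where "t = int q div 3"
  have "q mod 3 = 1"
    using assms(1) by (simp add: cong_def)
  hence t: "int q = 1 + 3 * t"
    unfolding t_def by presburger
  \<comment> \<open>With \<open>q = 1 + 3 * t\<close> one has \<open>c = 9 * K + 7 - 3 * t\<close>,
    and \<open>4 * q - c\<^sup>2\<close> becomes a multiple of 9.\<close>
  have "3 * e\<^sup>2 = 9 * (- (t - 1) * (t - 5) - 9 * (int K)\<^sup>2 - 2 * int K * (7 - 3 * t))"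
    using eq unfolding c_def t by (simp add: power2_eq_square algebra_simps)
  hence "3 dvd e\<^sup>2"
    by presburger
  hence "3 dvd e"
    using prime_dvd_power[of "3::int" e 2] by simp
  then obtain d where "e = 3 * d" ..
  thus ?thesis
    using eq by (intro exI[of _ d]) (simp add: power_mult_distrib)
qed

end

section \<open>Representation of powers of \<open>p\<close> by \<open>x\<^sup>2 + 27 y\<^sup>2\<close>\<close>

definition sqrt_minus_27 :: complex where
  "sqrt_minus_27 = 3 * of_real (sqrt 3) * \<i>"

lemma sqrt_minus_27_square: "sqrt_minus_27 * sqrt_minus_27 = - 27"
  by (simp add: sqrt_minus_27_def complex_eq_iff)

lemma Re_sqrt_minus_27: "Re (of_int a + of_int b * sqrt_minus_27) = of_int a"
  by (simp add: sqrt_minus_27_def)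

lemma mult_sqrt_minus_27:
  "(of_int a + of_int b * sqrt_minus_27) * (of_int x + of_int y * sqrt_minus_27)
     = of_int (a * x - 27 * b * y) + of_int (a * y + b * x) * sqrt_minus_27"
proof -
  have "(of_int a + of_int b * sqrt_minus_27) * (of_int x + of_int y * sqrt_minus_27)
     = of_int (a * x) + of_int (b * y) * (sqrt_minus_27 * sqrt_minus_27)
        + of_int (a * y + b * x) * sqrt_minus_27"
    by (simp add: algebra_simps)
  thus ?thesis
    by (simp add: sqrt_minus_27_square)
qed

text \<open>A descent replaces unique factorisation: writing z for the element given by
  \<open>x\<close> and \<open>y\<close>, of norm \<open>p\<close>, the condition on
  \<open>c * y - d * x\<close> says that z divides the element given by \<open>c\<close> and
  \<open>d\<close>. One factor z is removed at a time. As \<open>p\<close> does not divide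
  \<open>c\<close>, the conjugate of z never takes its place. At \<open>f = 0\<close> no factor
  remains to be removed, hence the guards on the last two assumptions.\<close>

lemma prime_power_quadratic_form_generator:
  fixes p :: nat and c d x y :: int
  assumes p: "prime p" "p > 3" "int p = x\<^sup>2 + 27 * y\<^sup>2"
    and "c\<^sup>2 + 27 * d\<^sup>2 = 4 * int p ^ f"
    and "f > 0 \<Longrightarrow> \<not> int p dvd c" "f > 0 \<Longrightarrow> int p dvd c * y - d * x"
  shows "\<exists>s\<in>{2, - 2}. of_int c + of_int d * sqrt_minus_27
           = s * (of_int x + of_int y * sqrt_minus_27) ^ f"
  using assms(4-6)
proof (induction f arbitrary: c d)
  case 0
  hence eq: "c\<^sup>2 + 27 * d\<^sup>2 = 4"
    by simp
  have "d = 0"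
  proof (rule ccontr)
    assume "d \<noteq> 0"
    hence "d\<^sup>2 > 0"
      by simp
    thus False
      using eq zero_le_power2[of c] by linarith
  qed
  moreover from this eq have "c\<^sup>2 = 2\<^sup>2"
    by simp
  hence "c = 2 \<or> c = - 2"
    unfolding power2_eq_iff .
  ultimately show ?case
    by auto
next
  case (Suc f)
  have pr: "prime (int p)"
    using p(1) by simp
  have p27: "\<not> int p dvd 27"
  proof
    assume "int p dvd 27"
    hence "int p dvd 3 ^ 3"
      by simp
    hence "int p dvd 3"
      using pr prime_dvd_power by blast
    thus False
      using p(2) zdvd_imp_le[of "int p" 3] by simp
  qed
  have p0: "int p \<noteq> 0"
    using p by auto
  have nc: "\<not> int p dvd c" and dv: "int p dvd c * y - d * x"
    using Suc.prems by auto
  \<comment> \<open>Multiplicativity of the norm, for the product with the conjugate of z. Since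
    \<open>p\<close> divides the second coordinate of this product, it divides the first as
    well.\<close>
  have norm: "(c * x + 27 * d * y)\<^sup>2 + 27 * (c * y - d * x)\<^sup>2 = 4 * int p ^ (f + 2)"
  proof -
    have "(c * x + 27 * d * y)\<^sup>2 + 27 * (c * y - d * x)\<^sup>2 = (c\<^sup>2 + 27 * d\<^sup>2) * (x\<^sup>2 + 27 * y\<^sup>2)"
      by (simp add: power2_eq_square algebra_simps)
    also have "\<dots> = 4 * int p ^ (f + 2)"
      unfolding Suc.prems(1) p(3)[symmetric] by simp
    finally show ?thesis .
  qed
  have "(c * x + 27 * d * y)\<^sup>2 = 4 * int p ^ (f + 2) - 27 * (c * y - d * x)\<^sup>2"
    using norm by simp
  also have "int p dvd \<dots>"
    using dv by (intro dvd_diff dvd_mult) (auto simp: power2_eq_square)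
  finally have "int p dvd c * x + 27 * d * y"
    using pr prime_dvd_power by blast
  then obtain c' where c': "c * x + 27 * d * y = int p * c'" ..
  have "int p dvd d * x - c * y"
    using dv by (metis dvd_minus_iff minus_diff_eq)
  then obtain d' where d': "d * x - c * y = int p * d'" ..
  \<comment> \<open>Multiplying the quotient by z recovers \<open>c\<close> and, below,
    \<open>d\<close>.\<close>
  have "int p * c = int p * (c' * x - 27 * d' * y)"
  proof -
    have "int p * c = c * (x\<^sup>2 + 27 * y\<^sup>2)"
      by (simp add: p(3))
    also have "\<dots> = (c * x + 27 * d * y) * x - 27 * (d * x - c * y) * y"
      by (simp add: power2_eq_square algebra_simps)
    also have "\<dots> = int p * (c' * x - 27 * d' * y)"
      unfolding c' d' by (simp add: algebra_simps)
    finally show ?thesis .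
  qed
  hence c: "c = c' * x - 27 * d' * y"
    using p0 by simp
  have "int p * d = int p * (c' * y + d' * x)"
  proof -
    have "int p * d = d * (x\<^sup>2 + 27 * y\<^sup>2)"
      by (simp add: p(3))
    also have "\<dots> = (c * x + 27 * d * y) * y + (d * x - c * y) * x"
      by (simp add: power2_eq_square algebra_simps)
    also have "\<dots> = int p * (c' * y + d' * x)"
      unfolding c' d' by (simp add: algebra_simps)
    finally show ?thesis .
  qed
  hence d: "d = c' * y + d' * x"
    using p0 by simp
  have "(int p)\<^sup>2 * (c'\<^sup>2 + 27 * d'\<^sup>2) = (c * x + 27 * d * y)\<^sup>2 + 27 * (d * x - c * y)\<^sup>2"
    unfolding c' d' by (simp add: power2_eq_square algebra_simps)
  also have "\<dots> = (int p)\<^sup>2 * (4 * int p ^ f)"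
    using norm by (simp add: power2_commute[of "d * x"] power_add power2_eq_square[of "int p"])
  finally have norm': "c'\<^sup>2 + 27 * d'\<^sup>2 = 4 * int p ^ f"
    using p0 by simp
  have "\<exists>s\<in>{2, - 2}. of_int c' + of_int d' * sqrt_minus_27
           = s * (of_int x + of_int y * sqrt_minus_27) ^ f"
  proof (rule Suc.IH[OF norm'])
    assume f: "f > 0"
    hence pf: "int p dvd 4 * int p ^ f"
      by simp
    show "\<not> int p dvd c'"
    proof
      assume *: "int p dvd c'"
      have "27 * d'\<^sup>2 = 4 * int p ^ f - c'\<^sup>2"
        using norm' by simp
      also have "int p dvd \<dots>"
        using * pf by (intro dvd_diff) (auto simp: power2_eq_square)
      finally have "int p dvd d'"
        using p27 prime_dvd_power[OF pr, of d' 2] by (auto simp: prime_dvd_mult_iff[OF pr])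
      thus False
        using * nc c by simp
    qed
    \<comment> \<open>One of the two factors is \<open>d\<close> itself, which \<open>p\<close>
      cannot divide because it would then divide \<open>c\<close>.\<close>
    have "(c' * y - d' * x) * (c' * y + d' * x) = (c'\<^sup>2 + 27 * d'\<^sup>2) * y\<^sup>2 - d'\<^sup>2 * (x\<^sup>2 + 27 * y\<^sup>2)"
      by (simp add: power2_eq_square algebra_simps)
    also have "int p dvd \<dots>"
      unfolding norm' p(3)[symmetric] using pf by (intro dvd_diff) auto
    finally have "int p dvd c' * y - d' * x \<or> int p dvd d"
      using pr d by (simp add: prime_dvd_mult_iff)
    moreover have "\<not> int p dvd d"
    proof
      assume *: "int p dvd d"
      have "c\<^sup>2 = 4 * int p ^ Suc f - 27 * d\<^sup>2"
        using Suc.prems(1) by simp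
      also have "int p dvd \<dots>"
        using * by (intro dvd_diff) (auto simp: power2_eq_square)
      finally show False
        using nc pr prime_dvd_power by blast
    qed
    ultimately show "int p dvd c' * y - d' * x"
      by blast
  qed
  then obtain s where s: "s \<in> {2, - 2}" "of_int c' + of_int d' * sqrt_minus_27
           = s * (of_int x + of_int y * sqrt_minus_27) ^ f"
    by blast
  have "of_int c + of_int d * sqrt_minus_27
      = (of_int c' + of_int d' * sqrt_minus_27) * (of_int x + of_int y * sqrt_minus_27)"
    unfolding mult_sqrt_minus_27 c d by simp
  also have "\<dots> = s * (of_int x + of_int y * sqrt_minus_27) ^ Suc f"
    unfolding s(2) by simp
  finally show ?case
    using s(1) by blast
qed

text \<open>Modulo 3 the rational part is multiplicative, because 27 vanishes. This congruence later
  decides a sign.\<close>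

lemma power_sqrt_minus_27:
  assumes "[x = 1] (mod 3)"
  shows "\<exists>u v. (of_int x + of_int y * sqrt_minus_27) ^ f = of_int u + of_int v * sqrt_minus_27
           \<and> [u = 1] (mod 3)"
proof (induction f)
  case 0
  show ?case
    by (intro exI[of _ 1] exI[of _ 0]) simp
next
  case (Suc f)
  then obtain u v where uv: "(of_int x + of_int y * sqrt_minus_27) ^ f = of_int u + of_int v * sqrt_minus_27"
    "[u = 1] (mod 3)"
    by blast
  have "[u * x - 27 * v * y = 1 * 1 - 0] (mod 3)"
    by (intro cong_diff cong_mult uv assms) (simp add: cong_0_iff)
  moreover have "(of_int x + of_int y * sqrt_minus_27) ^ Suc f
      = of_int (u * x - 27 * v * y) + of_int (u * y + v * x) * sqrt_minus_27"
    unfolding mult_sqrt_minus_27[symmetric] uv(1)[symmetric] by simp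
  ultimately show ?case
    by (intro exI[of _ "u * x - 27 * v * y"] exI[of _ "u * y + v * x"]) simp
qed

text \<open>The descent determines \<open>c\<close> up to sign as twice the rational part of a power
  of z; the congruences modulo 3 fix the sign.\<close>

lemma prime_power_quadratic_form_unique:
  fixes p :: nat and c d x y :: int
  assumes p: "prime p" "p > 3" "int p = x\<^sup>2 + 27 * y\<^sup>2" "[x = 1] (mod 3)"
    and f: "f > 0" and cd: "4 * int p ^ f = c\<^sup>2 + 27 * d\<^sup>2" "\<not> int p dvd c" "[c = 1] (mod 3)"
  shows "of_int c = - ((of_int x + of_int y * sqrt_minus_27) ^ f)
           - (of_int x - of_int y * sqrt_minus_27) ^ f"
proof -
  have pr: "prime (int p)"
    using p(1) by simp
  have "(c * y - d * x) * (c * y + d * x) = (c\<^sup>2 + 27 * d\<^sup>2) * y\<^sup>2 - d\<^sup>2 * (x\<^sup>2 + 27 * y\<^sup>2)"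
    by (simp add: power2_eq_square algebra_simps)
  also have "int p dvd \<dots>"
    unfolding cd(1)[symmetric] p(3)[symmetric] using f by (intro dvd_diff) auto
  \<comment> \<open>Only \<open>d\<^sup>2\<close> occurs in the form, so the sign of
    \<open>d\<close> may be chosen to make the descent applicable.\<close>
  finally have "int p dvd c * y - d * x \<or> int p dvd c * y - (- d) * x"
    using pr by (simp add: prime_dvd_mult_iff)
  then obtain e where e: "e = d \<or> e = - d" "int p dvd c * y - e * x"
    by blast
  hence "c\<^sup>2 + 27 * e\<^sup>2 = 4 * int p ^ f"
    using cd(1) by auto
  from prime_power_quadratic_form_generator[OF p(1-3) this] obtain s where
    s: "s \<in> {2, - 2}" "of_int c + of_int e * sqrt_minus_27
           = s * (of_int x + of_int y * sqrt_minus_27) ^ f"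
    using cd(2) e(2) by blast
  obtain u v where uv: "(of_int x + of_int y * sqrt_minus_27) ^ f = of_int u + of_int v * sqrt_minus_27"
      "[u = 1] (mod 3)"
    using power_sqrt_minus_27[OF p(4)] by blast
  have "(of_int x - of_int y * sqrt_minus_27) ^ f = cnj ((of_int x + of_int y * sqrt_minus_27) ^ f)"
    by (simp add: sqrt_minus_27_def)
  also have "\<dots> = of_int u - of_int v * sqrt_minus_27"
    unfolding uv(1) by (simp add: sqrt_minus_27_def)
  finally have sum: "- ((of_int x + of_int y * sqrt_minus_27) ^ f)
           - (of_int x - of_int y * sqrt_minus_27) ^ f = of_int (- 2 * u)"
    unfolding uv(1) by simp
  have "Re (of_int c + of_int e * sqrt_minus_27) = Re (s * (of_int u + of_int v * sqrt_minus_27))"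
    unfolding s(2) uv(1) ..
  hence "real_of_int c = (if s = 2 then of_int (2 * u) else of_int (- 2 * u))"
    using s(1) Re_sqrt_minus_27[of u v] Re_sqrt_minus_27[of c e] by auto
  hence "c = 2 * u \<or> c = - 2 * u"
    by (metis of_int_eq_iff)
  \<comment> \<open>Here \<open>2 * u\<close> is congruent to 2 modulo 3, whereas \<open>c\<close>
    is congruent to 1.\<close>
  moreover have "c \<noteq> 2 * u"
    using cd(3) uv(2) unfolding cong_def by presburger
  ultimately show ?thesis
    unfolding sum by simp
qed

text \<open>A nonzero \<open>x\<close> divisible by \<open>p\<close> would have a square of at least
  \<open>p\<^sup>2\<close>, and \<open>x = 0\<close> would make \<open>p\<close> divisible by
  3.\<close>

lemma prime_representation_coprime:
  fixes p :: nat and x y :: int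
  assumes "prime p" "p > 3" "int p = x\<^sup>2 + 27 * y\<^sup>2"
  shows "gcd x (int p) = 1"
proof -
  have pr: "prime (int p)"
    using assms(1) by simp
  have "\<not> int p dvd x"
  proof
    assume x: "int p dvd x"
    have "x \<noteq> 0"
    proof
      assume "x = 0"
      hence "int p = 3 * (9 * y\<^sup>2)"
        using assms by simp
      hence "(3::int) dvd int p"
        by (metis dvd_triv_left)
      hence "3 dvd p"
        by presburger
      thus False
        using primes_dvd_imp_eq[of 3 p] assms by simp
    qed
    hence "int p \<le> \<bar>x\<bar>"
      using x dvd_imp_le_int by force
    hence "int p * int p \<le> \<bar>x\<bar> * \<bar>x\<bar>"
      by (intro mult_mono) auto
    also have "\<dots> \<le> int p"
      using assms(3) zero_le_power2[of y] by (simp add: power2_eq_square)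
    finally show False
      using assms(2) by simp
  qed
  hence "coprime (int p) x"
    using pr prime_imp_coprime by blast
  thus ?thesis
    by (simp add: coprime_iff_gcd_eq_1 gcd.commute)
qed

section \<open>The integers modulo \<open>p\<close> and the representation of
  \<open>p\<close>\<close>

lemma primitive_cubic_nonresidue:
  fixes p :: nat
  assumes "prime p" "p - 1 = 3 * m" "m > 0"
  obtains g where "\<not> int p dvd int g" "\<not> int p dvd int g ^ m - 1"
proof -
  obtain g where g: "residue_primroot p g"
    using prime_primitive_root_exists[of p] assms(1) prime_gt_1_nat by blast
  hence ord: "coprime p g" "ord p g = 3 * m"
    using assms by (auto simp: residue_primroot_def totient_prime)
  have "\<not> [g ^ m = 1] (mod p)"
    using ord_minimal[of m p g] ord assms(3) by simp
  hence "\<not> [int g ^ m = 1] (mod int p)"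
    by (metis cong_int_iff of_nat_1 of_nat_power)
  moreover have "\<not> p dvd g"
    using ord(1) assms(1) by (meson coprime_absorb_left not_prime_unit)
  ultimately show ?thesis
    using that[of g] by (simp add: cong_iff_dvd_diff int_dvd_int_iff)
qed

lemma fermat_theorem_int:
  fixes p :: nat and x :: int
  assumes "prime p" "\<not> int p dvd x"
  shows "int p dvd x ^ (p - 1) - 1"
proof -
  define a where "a = nat (x mod int p)"
  have a: "int a = x mod int p"
    using assms by (simp add: a_def prime_gt_0_nat)
  hence "\<not> p dvd a"
    using assms(2) by (metis dvd_mod_iff dvd_refl int_dvd_int_iff)
  hence "[int a ^ (p - 1) = 1] (mod int p)"
    using fermat_theorem[OF assms(1)] by (metis cong_int_iff of_nat_1 of_nat_power)
  moreover have "[x ^ (p - 1) = int a ^ (p - 1)] (mod int p)"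
    by (intro cong_pow) (simp add: a cong_def)
  ultimately show ?thesis
    using cong_trans by (simp add: cong_iff_dvd_diff[symmetric]) blast
qed

lemma residue_field_int:
  fixes p :: nat
  assumes "prime p"
  shows "residue_field {0..<int p} {k. int p dvd k}"
proof -
  have p1: "int p > 1"
    using assms prime_gt_1_nat by simp
  have pr: "prime (int p)"
    using assms by simp
  show ?thesis
  proof
    fix x :: int
    show "\<exists>y\<in>{0..<int p}. x - y \<in> {k. int p dvd k}"
      using p1 by (intro bexI[of _ "x mod int p"]) auto
  next
    fix x y :: int assume xy: "x \<in> {0..<int p}" "y \<in> {0..<int p}" "x - y \<in> {k. int p dvd k}"
    hence "x mod int p = y mod int p"
      by (subst mod_eq_dvd_iff) simp
    thus "x = y"
      using xy(1,2) by simp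
  next
    fix x y :: int assume "x * y \<in> {k. int p dvd k}"
    thus "x \<in> {k. int p dvd k} \<or> y \<in> {k. int p dvd k}"
      using prime_dvd_mult_iff[OF pr, of x y] by simp
  qed (use p1 in auto)
qed

definition root_char :: "nat \<Rightarrow> int \<Rightarrow> complex" where
  "root_char p k = cis (2 * pi * (of_int k / of_nat p))"

lemma root_char_add: "root_char p (k + l) = root_char p k * root_char p l"
  by (simp add: root_char_def cis_mult add_divide_distrib algebra_simps)

lemma root_char_eq_1_iff:
  assumes "p > 0"
  shows "root_char p k = 1 \<longleftrightarrow> int p dvd k"
proof
  assume "int p dvd k"
  then obtain j where "k = int p * j" ..
  hence "real_of_int k / of_nat p = of_int j"
    using assms by simp
  thus "root_char p k = 1"
    by (simp add: root_char_def cis_multiple_2pi)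
next
  assume "root_char p k = 1"
  hence "cos (2 * pi * (of_int k / of_nat p)) = 1"
    by (simp add: root_char_def complex_eq_iff)
  then obtain j :: int where "2 * pi * (of_int k / of_nat p) = j * 2 * pi"
    by (auto simp: cos_one_2pi_int)
  hence "real_of_int k = of_int (j * int p)"
    using assms by (simp add: field_simps)
  thus "int p dvd k"
    by (metis of_int_eq_iff dvd_triv_right)
qed

lemma root_char_cong:
  assumes "p > 0" "[k = l] (mod int p)"
  shows "root_char p k = root_char p l"
proof -
  have "root_char p k = root_char p (k - l) * root_char p l"
    by (simp flip: root_char_add)
  moreover have "root_char p (k - l) = 1"
    using assms by (simp add: root_char_eq_1_iff cong_iff_dvd_diff)
  ultimately show ?thesis
    by simp
qed

lemma gauss_sums_int:
  fixes p :: nat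
  assumes "prime p" "p - 1 = 3 * m" "m > 0" "\<not> int p dvd nr" "\<not> int p dvd nr ^ m - 1"
  shows "gauss_sums {0..<int p} {k. int p dvd k} m nr (root_char p)"
proof -
  interpret residue_field "{0..<int p}" "{k. int p dvd k}"
    by (rule residue_field_int[OF assms(1)])
  have p1: "p > 1"
    using assms prime_gt_1_nat by simp
  show ?thesis
  proof
    fix x :: int assume "x \<notin> {k. int p dvd k}"
    thus "x ^ (3 * m) - 1 \<in> {k. int p dvd k}"
      using fermat_theorem_int[OF assms(1), of x] by (simp flip: assms(2))
  next
    have "root_char p 1 \<noteq> 1"
      using p1 by (simp add: root_char_eq_1_iff)
    thus "\<exists>k. root_char p k \<noteq> 1"
      by blast
  qed (use assms p1 in \<open>auto simp: root_char_add root_char_eq_1_iff\<close>)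
qed

text \<open>The form \<open>4 * p = c\<^sup>2 + 27 * d\<^sup>2\<close> can be divided by 4 once
  \<open>c\<close> is even, and the parity of \<open>c\<close> is read off from that of
  \<open>K\<close>.\<close>

theorem exists_cubic_representation:
  fixes p :: nat
  assumes "prime p" and "[p = 1] (mod 3)" and "cubic_residue p 2"
  shows "\<exists>x y. cubic_representation p x y"
proof -
  have p1: "p > 1"
    using assms prime_gt_1_nat by simp
  define m where "m = (p - 1) div 3"
  have p3m: "p = 3 * m + 1"
    using assms(2) p1 unfolding m_def cong_def by presburger
  hence m: "p - 1 = 3 * m" "m > 0"
    using p1 by auto
  have "p \<noteq> 2"
    using p3m by presburger
  hence p3: "p > 3" and "odd p"
    using p1 p3m assms(1) prime_odd_nat[of p] by auto
  obtain g where g: "\<not> int p dvd int g" "\<not> int p dvd int g ^ m - 1"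
    using primitive_cubic_nonresidue[OF assms(1) m] .
  interpret gauss_sums "{0..<int p}" "{k. int p dvd k}" m "int g" "root_char p"
    by (rule gauss_sums_int[OF assms(1) m g])
  obtain t where "[2 = t ^ 3] (mod int p)"
    using assms(3) by (auto simp: cubic_residue_def)
  hence "chi 2 = chi (t ^ 3)"
    by (intro periodicD[OF chi_periodic]) (simp add: cong_iff_dvd_diff)
  also have "\<dots> = chi t ^ 3"
    by (simp add: power3_eq_cube chi_mult)
  finally have *: "chi 2 = chi t ^ 3" .
  have "\<not> int p dvd 2"
    using p3 zdvd_imp_le[of "int p" 2] by auto
  hence "chi 2 \<noteq> 0"
    by (simp add: chi_eq_0_iff)
  hence "chi t \<noteq> 0"
    using * by auto
  hence chi_two: "chi 2 = 1"
    using * chi_cube[of t] by (simp add: chi_eq_0_iff)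
  define X where "X = {x \<in> {0..<int p} - {0, 1}. chi x = 1 \<and> chi (1 - x) = 1}"
  \<comment> \<open>For \<open>x\<close> other than 0 and 1, the representative of
    \<open>1 - x\<close> in the range is \<open>p + 1 - x\<close>.\<close>
  have X_reflect: "int p + 1 - x \<in> X" if "x \<in> X" for x
  proof -
    have "chi (int p + 1 - x) = chi (1 - x)" "chi (1 - (int p + 1 - x)) = chi x"
      by (rule periodicD[OF chi_periodic]; simp)+
    thus ?thesis
      using that by (auto simp: X_def)
  qed
  \<comment> \<open>The inverse of 2 modulo \<open>p\<close>, which is the fixed point of the
    reflection. It lies in \<open>X\<close> because \<open>chi 2 = 1\<close>.\<close>
  define h where "h = (int p + 1) div 2"
  have h: "2 * h = int p + 1"
    using p3m \<open>odd p\<close> unfolding h_def by presburger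
  have "chi h = chi (2 * h)"
    by (simp only: chi_mult chi_two mult_1)
  also have "\<dots> = chi 1"
    unfolding h by (rule periodicD[OF chi_periodic]) simp
  finally have "chi h = 1"
    by (simp add: chi_one)
  moreover have "chi (1 - h) = chi h"
    by (rule periodicD[OF chi_periodic]) (use h in simp)
  ultimately have "h \<in> X"
    using h p3 by (auto simp: X_def)
  have fin: "finite X"
    by (rule finite_subset[of _ "{0..<int p}"]) (auto simp: X_def)
  define A where "A = {x \<in> X. x < h}"
  have X_eq: "X = insert h (A \<union> (\<lambda>x. int p + 1 - x) ` A)"
  proof (intro subset_antisym subsetI)
    fix x assume "x \<in> insert h (A \<union> (\<lambda>x. int p + 1 - x) ` A)"
    thus "x \<in> X"
      using \<open>h \<in> X\<close> X_reflect by (auto simp: A_def)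
  next
    fix x assume x: "x \<in> X"
    show "x \<in> insert h (A \<union> (\<lambda>x. int p + 1 - x) ` A)"
    proof (cases "x \<le> h")
      case False
      hence "int p + 1 - x \<in> A"
        using h X_reflect[OF x] by (simp add: A_def)
      thus ?thesis
        by (auto simp: image_iff intro!: bexI[of _ "int p + 1 - x"])
    qed (use x in \<open>auto simp: A_def\<close>)
  qed
  have "K = card X"
    by (simp add: K_def X_def)
  also have "\<dots> = Suc (card A + card ((\<lambda>x. int p + 1 - x) ` A))"
    using fin h unfolding X_eq
    by (subst card_insert_disjoint, force simp: A_def, force simp: A_def)
       (subst card_Un_disjoint; force simp: A_def)
  also have "card ((\<lambda>x. int p + 1 - x) ` A) = card A"
    by (intro card_image inj_onI) simp
  finally have K: "odd K"
    by simp
  define c where "c = 9 * int K + 8 - int p"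
  have "card {0..<int p} = p"
    by simp
  then obtain d where d: "4 * int p = c\<^sup>2 + 27 * d\<^sup>2"
    using card_S_quadratic_form assms(2) unfolding c_def by metis
  have "even c"
    using K \<open>odd p\<close> by (simp add: c_def)
  then obtain x where x: "c = 2 * x" ..
  have "27 * d\<^sup>2 = 2 * (2 * int p - 2 * x\<^sup>2)"
    using d x by (simp add: power2_eq_square)
  hence "even (27 * d\<^sup>2)"
    by (metis dvd_triv_left)
  hence "even d"
    by simp
  then obtain y where y: "d = 2 * y" ..
  have pxy: "int p = x\<^sup>2 + 27 * y\<^sup>2"
    using d x y by (simp add: power_mult_distrib)
  have "int p = 3 * int m + 1"
    using p3m by simp
  \<comment> \<open>From \<open>2 * x = c\<close> and \<open>c\<close> congruent to 1 it follows
    that \<open>x\<close> is congruent to 2, so \<open>- x\<close> is the normalised choice.\<close>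
  hence "[- x = 1] (mod 3)"
    using x unfolding c_def cong_def by presburger
  moreover have "gcd (- x) (int p) = 1"
    using prime_representation_coprime[OF assms(1) p3 pxy] by simp
  ultimately show ?thesis
    using pxy by (intro exI[of _ "- x"] exI[of _ y]) (simp add: cubic_representation_def)
qed

section \<open>Finite fields\<close>

lemma multiplicity_fact_div:
  fixes p :: nat
  assumes p: "prime p" and "s < p"
  shows "multiplicity p (fact (p * a + s) :: nat) = a + multiplicity p (fact a :: nat)"
proof -
  have pe: "prime_elem p" and p0: "p \<noteq> 0"
    using p by auto
  have fact_Suc': "multiplicity p (fact (Suc n) :: nat) = multiplicity p (Suc n) + multiplicity p (fact n :: nat)"
    for n
  proof -
    have "multiplicity p (Suc n * fact n) = multiplicity p (Suc n) + multiplicity p (fact n :: nat)"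
      by (rule prime_elem_multiplicity_mult_distrib[OF pe]) auto
    thus ?thesis
      by simp
  qed
  \<comment> \<open>Legendre's formula in recursive form: the factors between consecutive multiples
    of \<open>p\<close> are prime to \<open>p\<close>, and the multiples up to \<open>p * a\<close>
    contribute \<open>a\<close> plus the exponent in \<open>fact a\<close>.\<close>
  have step: "multiplicity p (fact (p * a + t) :: nat) = multiplicity p (fact (p * a) :: nat)"
    if "t < p" for a t
    using that
  proof (induction t)
    case (Suc t)
    have "\<not> p dvd Suc (p * a + t)"
    proof
      assume "p dvd Suc (p * a + t)"
      hence "p dvd p * a + Suc t"
        by simp
      hence "p dvd Suc t"
        by (subst (asm) dvd_add_right_iff) auto
      thus False
        using Suc.prems dvd_imp_le by fastforce
    qed
    hence "multiplicity p (Suc (p * a + t)) = 0"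
      by (rule not_dvd_imp_multiplicity_0)
    thus ?case
      using fact_Suc'[of "p * a + t"] Suc by simp
  qed simp
  have "multiplicity p (fact (p * a) :: nat) = a + multiplicity p (fact a :: nat)"
  proof (induction a)
    case (Suc a)
    have eq: "p * Suc a = Suc (p * a + (p - 1))"
      using p0 by simp
    have "multiplicity p (fact (p * Suc a) :: nat)
        = multiplicity p (p * Suc a) + multiplicity p (fact (p * a + (p - 1)) :: nat)"
      unfolding eq by (rule fact_Suc')
    also have "multiplicity p (fact (p * a + (p - 1)) :: nat) = multiplicity p (fact (p * a) :: nat)"
      using p0 by (intro step) simp
    also have "multiplicity p (p * Suc a) = 1 + multiplicity p (Suc a)"
      using prime_elem_multiplicity_mult_distrib[OF pe p0, of "Suc a"] p0 p
      by (simp add: multiplicity_self)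
    finally show ?case
      unfolding Suc.IH fact_Suc' by simp
  qed simp
  thus ?thesis
    using step[OF assms(2)] by simp
qed

text \<open>Passing from \<open>f\<close> to \<open>Suc f\<close> appends the digit \<open>r\<close>
  in base \<open>p\<close>.\<close>

lemma prime_power_minus_1_third:
  fixes p :: nat
  assumes "p = 3 * r + 1"
  shows "(p ^ Suc f - 1) div 3 = p * ((p ^ f - 1) div 3) + r"
proof -
  have "[p ^ f = 1 ^ f] (mod 3)"
    by (intro cong_pow) (simp add: assms cong_def)
  hence "p ^ f mod 3 = 1"
    by (simp add: cong_def)
  define t where "t = p ^ f div 3"
  have t: "p ^ f = 3 * t + 1"
    using \<open>p ^ f mod 3 = 1\<close> unfolding t_def by presburger
  have "p ^ Suc f = 3 * (p * t) + p"
    by (simp add: t)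
  also have "\<dots> = 3 * (p * t + r) + 1"
    by (subst (2) assms) simp
  finally have "p ^ Suc f - 1 = 3 * (p * t + r)"
    by simp
  thus ?thesis
    unfolding t by simp
qed

text \<open>The base-\<open>p\<close> digits of \<open>m\<close> are all \<open>(p - 1) / 3\<close>, so adding \<open>m + m\<close> produces no carry.\<close>

lemma prime_not_dvd_central_binomial:
  fixes p :: nat
  assumes p: "prime p" "p = 3 * r + 1"
  defines "m \<equiv> \<lambda>f. (p ^ f - 1) div 3"
  shows "\<not> p dvd (2 * m f) choose (m f)"
proof -
  have mult: "multiplicity p (fact (2 * m f) :: nat) = 2 * multiplicity p (fact (m f) :: nat)"
  proof (induction f)
    case 0
    show ?case
      by (simp add: m_def)
  next
    case (Suc f)
    have m: "m (Suc f) = p * m f + r" "2 * m (Suc f) = p * (2 * m f) + 2 * r"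
      using prime_power_minus_1_third[OF p(2), of f] unfolding m_def by simp_all
    \<comment> \<open>Otherwise \<open>p\<close> would be 1. The bound \<open>2 * r < p\<close>
      obtained next is the absence of a carry.\<close>
    have "r > 0"
      using p by (cases r) auto
    hence r: "r < p" "2 * r < p"
      using p(2) by auto
    have "multiplicity p (fact (m (Suc f)) :: nat) = m f + multiplicity p (fact (m f) :: nat)"
      and "multiplicity p (fact (2 * m (Suc f)) :: nat)
             = 2 * m f + multiplicity p (fact (2 * m f) :: nat)"
      unfolding m(2) unfolding m(1)
      by (rule multiplicity_fact_div[OF p(1) r(1)], rule multiplicity_fact_div[OF p(1) r(2)])
    thus ?case
      using Suc by simp
  qed
  have pe: "prime_elem p"
    using p by simp
  have "(fact (2 * m f) :: nat) = (fact (m f) * fact (m f)) * ((2 * m f) choose (m f))"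
    using binomial_fact_lemma[of "m f" "2 * m f"] by simp
  hence "multiplicity p (fact (2 * m f) :: nat)
      = multiplicity p (fact (m f) * fact (m f) :: nat) + multiplicity p ((2 * m f) choose (m f))"
    using prime_elem_multiplicity_mult_distrib[OF pe, of "fact (m f) * fact (m f)" "(2 * m f) choose (m f)"]
    by simp
  also have "multiplicity p (fact (m f) * fact (m f) :: nat) = 2 * multiplicity p (fact (m f) :: nat)"
    using prime_elem_multiplicity_mult_distrib[OF pe, of "fact (m f)" "fact (m f)"] by simp
  finally have "multiplicity p ((2 * m f) choose (m f)) = 0"
    using mult by simp
  thus ?thesis
    using p(1) by (subst (asm) multiplicity_eq_zero_iff) auto
qed

lemma CHAR_eq_prime:
  assumes "CARD('a::{field,finite}) = p ^ f" "prime p"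
  shows "CHAR('a) = p"
proof -
  have "CHAR('a) dvd p ^ f"
    using CHAR_dvd_CARD[where ?'a = 'a] assms by simp
  moreover have "CHAR('a) > 0"
    using calculation assms(2) by (intro Nat.gr0I) auto
  hence "prime CHAR('a)"
    by (rule prime_CHAR_semidom)
  ultimately show ?thesis
    using assms(2) prime_dvd_power primes_dvd_imp_eq by blast
qed

section \<open>Powers, roots and power sums in finite fields\<close>

lemma finite_field_power_card_minus_1:
  fixes x :: "'a::{field,finite}"
  assumes "x \<noteq> 0"
  shows "x ^ (CARD('a) - 1) = 1"
proof -
  have "(\<Prod>y\<in>UNIV - {0}. x * y) = x ^ (CARD('a) - 1) * \<Prod>(UNIV - {0 :: 'a})"
    by (simp add: prod.distrib)
  moreover have "(\<Prod>y\<in>UNIV - {0}. x * y) = \<Prod>(UNIV - {0 :: 'a})"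
    by (rule prod.reindex_bij_witness[of _ "\<lambda>y. y / x" "\<lambda>y. x * y"]) (use assms in auto)
  ultimately show ?thesis
    by simp
qed

lemma card_power_eq_le:
  fixes n :: nat
  assumes "n > 0"
  shows "card {x::'a::{field,finite}. x ^ n = c} \<le> n"
proof -
  define P :: "'a poly" where "P = Polynomial.monom 1 n - [:c:]"
  have "Polynomial.coeff P n = 1"
    using assms by (simp add: P_def coeff_pCons split: nat.split)
  hence "P \<noteq> 0"
    by auto
  moreover have "degree P \<le> n"
    unfolding P_def by (intro degree_diff_le degree_monom_le) simp
  moreover have "{x. poly P x = 0} = {x. x ^ n = c}"
    by (simp add: P_def poly_monom)
  ultimately show ?thesis
    using card_poly_roots_bound[of P] by simp
qed

lemma exists_power_neq_1:
  assumes "0 < n" "n < CARD('a) - 1"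
  shows "\<exists>x::'a::{field,finite}. x \<noteq> 0 \<and> x ^ n \<noteq> 1"
proof (rule ccontr)
  assume "\<not> ?thesis"
  hence "UNIV - {0} \<subseteq> {x::'a. x ^ n = 1}"
    by auto
  hence "card (UNIV - {0::'a}) \<le> card {x::'a. x ^ n = 1}"
    by (intro card_mono) auto
  also have "\<dots> \<le> n"
    by (rule card_power_eq_le[OF assms(1)])
  finally have "card (UNIV - {0::'a}) \<le> n" .
  thus False
    using assms by simp
qed

text \<open>If the order of the unit group does not divide \<open>k\<close>, a dilation by some
  \<open>a\<close> with \<open>a ^ k \<noteq> 1\<close> kills the sum. For \<open>k = 0\<close> all
  terms are 1, including the one at 0, and the sum is the field size, which vanishes in the
  field.\<close>

lemma sum_powers_finite_field:
  "(\<Sum>x\<in>UNIV. (x::'a::{field,finite}) ^ k) = (if k > 0 \<and> CARD('a) - 1 dvd k then - 1 else 0)"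
proof -
  define n where "n = CARD('a) - 1"
  have card: "CARD('a) = n + 1" "n > 0"
  proof -
    have "card {0, 1::'a} \<le> CARD('a)"
      by (rule card_mono) auto
    thus "CARD('a) = n + 1" "n > 0"
      by (auto simp: n_def)
  qed
  have fermat: "x ^ n = 1" if "x \<noteq> 0" for x :: 'a
    using finite_field_power_card_minus_1[OF that] by (simp add: n_def)
  have of_nat_n: "of_nat n = (- 1 :: 'a)"
  proof -
    have "of_nat (n + 1) = (0::'a)"
      unfolding card(1)[symmetric] using CHAR_dvd_CARD[where ?'a = 'a] of_nat_eq_0_iff_char_dvd by blast
    thus ?thesis
      by (simp add: eq_neg_iff_add_eq_0 add.commute)
  qed
  consider "k = 0" | "k > 0" "n dvd k" | "\<not> n dvd k"
    by auto
  thus ?thesis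
  proof cases
    case 1
    thus ?thesis
      using of_nat_n by (simp add: card)
  next
    case 2
    then obtain j where j: "k = n * j"
      by (elim dvdE)
    have "(\<Sum>x\<in>UNIV. (x::'a) ^ k) = (\<Sum>x\<in>UNIV - {0}. x ^ k)"
      using 2 by (subst sum.remove[of _ 0]) (auto simp: power_0_left)
    also have "\<dots> = (\<Sum>x\<in>UNIV - {0::'a}. 1)"
      by (intro sum.cong) (auto simp: j power_mult fermat)
    also have "\<dots> = of_nat n"
      by (simp add: card)
    finally show ?thesis
      using 2 of_nat_n by (simp add: n_def)
  next
    case 3
    define j where "j = k mod n"
    have j: "0 < j" "j < n"
      using 3 card by (auto simp: j_def dvd_eq_mod_eq_0)
    obtain a :: 'a where a: "a \<noteq> 0" "a ^ j \<noteq> 1"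
      using exists_power_neq_1[of j, where ?'a = 'a] j by (auto simp: n_def)
    have "a ^ k = (a ^ n) ^ (k div n) * a ^ j"
      unfolding j_def by (metis mult_div_mod_eq power_add power_mult)
    hence ak: "a ^ k \<noteq> 1"
      using a fermat by simp
    have "(\<Sum>x\<in>UNIV. (a * x) ^ k) = (\<Sum>x\<in>UNIV. (x::'a) ^ k)"
      by (rule sum.reindex_bij_witness[of _ "\<lambda>y. y / a" "\<lambda>y. a * y"]) (use a in auto)
    hence "a ^ k * (\<Sum>x\<in>UNIV. x ^ k) = (\<Sum>x\<in>UNIV. x ^ k)"
      by (simp add: power_mult_distrib sum_distrib_left)
    hence "(\<Sum>x\<in>UNIV. (x::'a) ^ k) = 0"
      using ak by simp
    thus ?thesis
      using 3 by (auto simp: n_def)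
  qed
qed

section \<open>The absolute trace and the additive character of a finite field\<close>

context
  fixes p f :: nat
  assumes p: "prime p" and card_a: "CARD('a::{field,finite}) = p ^ f" and f: "f > 0"
begin

text \<open>The trace to the prime field as the sum of the Frobenius conjugates, with values left in
  the big field.\<close>

definition field_trace :: "'a \<Rightarrow> 'a" where
  "field_trace x = (\<Sum>i<f. x ^ (p ^ i))"

lemma field_trace_add: "field_trace (x + y) = field_trace x + field_trace y"
proof -
  have "(x + y) ^ (p ^ i) = x ^ (p ^ i) + y ^ (p ^ i)" for i
    by (rule freshmans_dream') (use CHAR_eq_prime[OF card_a p] p in auto)
  thus ?thesis
    by (simp add: field_trace_def sum.distrib)
qed

text \<open>Frobenius shifts the conjugates by one place, and the new last one,
  \<open>x ^ (p ^ f)\<close>, is \<open>x\<close> again.\<close>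

lemma field_trace_power: "field_trace x ^ p = field_trace x"
proof -
  have "x ^ (p ^ f) = x"
  proof (cases "x = 0")
    case False
    have "x ^ (p ^ f) = x * x ^ (CARD('a) - 1)"
      by (metis card_a zero_less_card_finite power_eq_if not_gr0)
    thus ?thesis
      using finite_field_power_card_minus_1[OF False] by simp
  qed (use p in \<open>simp add: power_0_left prime_gt_0_nat\<close>)
  have "field_trace x ^ p = (\<Sum>i<f. (x ^ (p ^ i)) ^ p)"
    unfolding field_trace_def
    by (rule freshmans_dream_sum) (use CHAR_eq_prime[OF card_a p] p in auto)
  also have "\<dots> = (\<Sum>i<f. x ^ (p ^ Suc i))"
    by (simp add: mult.commute flip: power_mult)
  also have "\<dots> = (\<Sum>i<f. x ^ (p ^ i)) + x ^ (p ^ f) - x ^ (p ^ 0)"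
    using sum.lessThan_Suc_shift[of "\<lambda>i. x ^ (p ^ i)" f] by (simp add: algebra_simps)
  finally show ?thesis
    using \<open>x ^ (p ^ f) = x\<close> by (simp add: field_trace_def)
qed

text \<open>The polynomial \<open>P\<close> has at most \<open>p\<close> roots, and the
  \<open>p\<close> elements of the prime field already exhaust them.\<close>

lemma field_trace_in_prime_field: "\<exists>k::int. of_int k = field_trace x"
proof -
  define P :: "'a poly" where "P = Polynomial.monom 1 p - Polynomial.monom 1 1"
  have "Polynomial.coeff P p = 1"
    using prime_gt_1_nat[OF p] by (simp add: P_def)
  hence "P \<noteq> 0"
    by auto
  have "degree P \<le> p"
    unfolding P_def using prime_gt_1_nat[OF p]
    by (intro degree_diff_le degree_monom_le order_trans[OF degree_monom_le]) auto
  hence card: "card {x. poly P x = 0} \<le> p"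
    using card_poly_roots_bound[OF \<open>P \<noteq> 0\<close>] by simp
  have roots: "{x. poly P x = 0} = {x. x ^ p = x}"
    by (simp add: P_def poly_monom)
  have char: "CHAR('a) = p"
    by (rule CHAR_eq_prime[OF card_a p])
  have "inj_on (of_nat :: nat \<Rightarrow> 'a) {..<p}"
    by (rule inj_onI) (auto simp: of_nat_eq_iff_cong_CHAR char cong_def)
  hence "card (of_nat ` {..<p} :: 'a set) = p"
    by (simp add: card_image)
  moreover have "(of_nat ` {..<p} :: 'a set) \<subseteq> {x. x ^ p = x}"
  proof clarsimp
    fix k :: nat
    \<comment> \<open>Writing \<open>k\<close> as a sum of ones lets additivity of Frobenius prove
      Fermat's congruence.\<close>
    have "(\<Sum>i<k. 1 :: 'a) ^ p = (\<Sum>i<k. 1 ^ p)"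
      by (rule freshmans_dream_sum) (use char p in auto)
    thus "(of_nat k :: 'a) ^ p = of_nat k"
      by simp
  qed
  ultimately have "(of_nat ` {..<p} :: 'a set) = {x. x ^ p = x}"
    using card by (intro card_seteq) (auto simp: roots)
  hence "field_trace x \<in> of_nat ` {..<p}"
    using field_trace_power by simp
  then obtain k where "field_trace x = of_nat k"
    by blast
  thus ?thesis
    by (intro exI[of _ "int k"]) simp
qed

text \<open>The trace is a nonzero polynomial function of degree at most \<open>p ^ (f - 1)\<close>,
  too small to vanish on the whole field.\<close>

lemma field_trace_nontrivial: "\<exists>x. field_trace x \<noteq> 0"
proof (rule ccontr)
  assume *: "\<nexists>x. field_trace x \<noteq> 0"
  have p1: "p > 1"
    using p by (rule prime_gt_1_nat)
  define P :: "'a poly" where "P = (\<Sum>i<f. Polynomial.monom 1 (p ^ i))"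
  have "Polynomial.coeff P 1 = (\<Sum>i<f. if p ^ i = 1 then 1 else 0)"
    by (simp add: P_def coeff_sum)
  also have "\<dots> = (\<Sum>i<f. if i = 0 then 1 else 0)"
    using p1 by (intro sum.cong) auto
  also have "\<dots> = 1"
    using f by simp
  finally have "P \<noteq> 0"
    by auto
  have "degree P \<le> p ^ (f - 1)"
    unfolding P_def using p1
    by (intro degree_sum_le order_trans[OF degree_monom_le] power_increasing) auto
  also have "\<dots> < p ^ f"
    using p1 f by simp
  finally have "card {x. poly P x = 0} < p ^ f"
    using card_poly_roots_bound[OF \<open>P \<noteq> 0\<close>] by simp
  moreover have "poly P x = field_trace x" for x
    by (simp add: P_def poly_sum poly_monom field_trace_def)
  ultimately show False
    using * card_a by simp
qed

text \<open>Any integer lift of the trace may be chosen, since two lifts differ by a multiple of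
  \<open>p\<close>; \<open>field_char_eq\<close> records this.\<close>

definition field_char :: "'a \<Rightarrow> complex" where
  "field_char x = root_char p (SOME k. of_int k = field_trace x)"

lemma field_char_eq: "of_int k = field_trace x \<Longrightarrow> field_char x = root_char p k"
proof -
  assume k: "of_int k = field_trace x"
  define l :: int where "l = (SOME k. of_int k = field_trace x)"
  have "of_int l = field_trace x"
    unfolding l_def using field_trace_in_prime_field by (rule someI_ex)
  hence "(of_int l :: 'a) = of_int k"
    using k by simp
  hence "[l = k] (mod int p)"
    using CHAR_eq_prime[OF card_a p] by (simp add: of_int_eq_iff_cong_CHAR)
  thus ?thesis
    using p unfolding field_char_def l_def[symmetric] by (intro root_char_cong) (auto simp: prime_gt_0_nat)
qed

lemma residue_field_finite_field: "residue_field (UNIV :: 'a set) {0}"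
  by standard auto

lemma gauss_sums_finite_field:
  assumes "CARD('a) - 1 = 3 * m" "m > 0" "nr \<noteq> 0" "nr ^ m \<noteq> 1"
  shows "gauss_sums UNIV {0::'a} m nr field_char"
proof -
  interpret residue_field UNIV "{0::'a}"
    by (rule residue_field_finite_field)
  show ?thesis
  proof
    fix x :: 'a assume "x \<notin> {0}"
    thus "x ^ (3 * m) - 1 \<in> {0}"
      using finite_field_power_card_minus_1[of x] assms(1) by simp
  next
    fix x y :: 'a
    obtain k l :: int where kl: "of_int k = field_trace x" "of_int l = field_trace y"
      using field_trace_in_prime_field by metis
    hence "of_int (k + l) = field_trace (x + y)"
      by (simp add: field_trace_add)
    thus "field_char (x + y) = field_char x * field_char y"
      using field_char_eq kl root_char_add by metis
  next
    fix x :: 'a assume "x \<in> {0}"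
    hence "of_int 0 = field_trace x"
      using prime_gt_0_nat[OF p] by (simp add: field_trace_def power_0_left)
    hence "field_char x = root_char p 0"
      by (rule field_char_eq)
    thus "field_char x = 1"
      using p by (simp add: root_char_eq_1_iff prime_gt_0_nat)
  next
    obtain x where x: "field_trace x \<noteq> 0"
      using field_trace_nontrivial by blast
    obtain k :: int where k: "of_int k = field_trace x"
      using field_trace_in_prime_field by blast
    hence "\<not> int p dvd k"
      using x CHAR_eq_prime[OF card_a p] of_int_eq_0_iff_char_dvd[of k, where ?'a = 'a] by simp
    thus "\<exists>x. field_char x \<noteq> 1"
      using field_char_eq[OF k] p by (intro exI[of _ x]) (simp add: root_char_eq_1_iff prime_gt_0_nat)
  qed (use assms in auto)
qed

end

section \<open>The trace of the Jacobi sum modulo \<open>p\<close>\<close>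

lemma sum_power_mult_power:
  fixes m i j :: nat
  assumes "CARD('a) - 1 = 3 * m" "m > 0" "i \<le> 3 * m" "i + j < 6 * m"
  shows "(\<Sum>x\<in>UNIV. (x::'a::{field,finite}) ^ i * (1 - x) ^ j)
           = - ((- 1) ^ (3 * m - i) * of_nat (j choose (3 * m - i)))"
proof -
  have "(1 - x) ^ j = (\<Sum>l\<le>j. of_nat (j choose l) * (- 1) ^ l * x ^ l)" for x :: 'a
    using binomial_ring[of "- x" 1 j] by (simp add: power_minus[of x] mult.assoc)
  hence "(\<Sum>x\<in>UNIV. (x::'a) ^ i * (1 - x) ^ j)
      = (\<Sum>x\<in>UNIV. \<Sum>l\<le>j. of_nat (j choose l) * (- 1) ^ l * x ^ (i + l))"
    by (simp add: sum_distrib_left power_add mult_ac)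
  also have "\<dots> = (\<Sum>l\<le>j. of_nat (j choose l) * (- 1) ^ l * (\<Sum>x\<in>UNIV. (x::'a) ^ (i + l)))"
    by (subst sum.swap) (simp add: sum_distrib_left)
  also have "\<dots> = (\<Sum>l\<le>j. if l = 3 * m - i then - (of_nat (j choose l) * (- 1) ^ l) else 0)"
  proof (rule sum.cong[OF refl])
    fix l assume "l \<in> {..j}"
    hence "i + l < 2 * (3 * m)"
      using assms by simp
    \<comment> \<open>After the binomial expansion only exponents that are positive multiples of
      \<open>3 * m\<close> survive, and the bound below \<open>6 * m\<close> leaves just
      one.\<close>
    have "i + l = 3 * m" if pos: "i + l > 0" and dvd: "3 * m dvd i + l"
    proof -
      obtain k where k: "i + l = 3 * m * k"
        using dvd by (elim dvdE)
      hence "k < 2"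
        using \<open>i + l < 2 * (3 * m)\<close> by (metis mult.commute mult_less_cancel2)
      moreover have "k \<noteq> 0"
        using k pos by (intro notI) simp
      ultimately have "k = 1"
        by linarith
      thus ?thesis
        using k by simp
    qed
    hence "i + l > 0 \<and> 3 * m dvd i + l \<longleftrightarrow> i + l = 3 * m"
      using assms(2) by auto
    also have "\<dots> \<longleftrightarrow> l = 3 * m - i"
      using assms(3) by auto
    finally have "i + l > 0 \<and> 3 * m dvd i + l \<longleftrightarrow> l = 3 * m - i" .
    thus "of_nat (j choose l) * (- 1) ^ l * (\<Sum>x\<in>UNIV. (x::'a) ^ (i + l))
        = (if l = 3 * m - i then - (of_nat (j choose l) * (- 1) ^ l) else 0)"
      unfolding sum_powers_finite_field assms(1) by simp
  qed
  also have "\<dots> = - ((- 1) ^ (3 * m - i) * of_nat (j choose (3 * m - i)))"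
    by (auto simp: mult.commute binomial_eq_0)
  finally show ?thesis .
qed

text \<open>\<open>P\<close> is the counterpart of \<open>indicator3\<close> with values in the
  field itself. As in \<open>J_add_J'\<close>, a sum over \<open>P x * P (1 - x)\<close> is computed
  by counting and by expansion, this time into power sums.\<close>

lemma card_consecutive_cubes:
  fixes m :: nat
  assumes m: "CARD('a::{field,finite}) - 1 = 3 * m" "m > 0" "even m"
  shows "(of_nat (9 * card {x \<in> UNIV - {0, 1::'a}. x ^ m = 1 \<and> (1 - x) ^ m = 1} + 8) :: 'a)
           = - of_nat ((2 * m) choose m)"
proof -
  define X where "X = {x \<in> UNIV - {0, 1::'a}. x ^ m = 1 \<and> (1 - x) ^ m = 1}"
  define P :: "'a \<Rightarrow> 'a" where "P = (\<lambda>x. 1 + x ^ m + x ^ (2 * m))"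
  have P: "P x = (if x ^ m = 1 then 3 else 0)" if "x \<noteq> 0" for x
  proof -
    have "P x = 1 + x ^ m + x ^ m * x ^ m"
      by (simp add: P_def mult_2 power_add)
    hence "(x ^ m - 1) * P x = (x ^ m) ^ 3 - 1"
      by (simp add: algebra_simps power3_eq_cube)
    also have "\<dots> = x ^ (3 * m) - 1"
      by (simp add: mult.commute flip: power_mult)
    also have "\<dots> = 0"
      using finite_field_power_card_minus_1[OF that] m by simp
    finally show ?thesis
      by (auto simp: P_def mult_2 power_add)
  qed
  have "(\<Sum>x\<in>UNIV. P x * P (1 - x)) = P 0 * P 1 + P 1 * P 0 + (\<Sum>x\<in>UNIV - {0} - {1}. P x * P (1 - x))"
    by (subst sum.remove[of _ 0], simp, simp, subst sum.remove[of _ 1]) auto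
  also have "(\<Sum>x\<in>UNIV - {0} - {1}. P x * P (1 - x)) = (\<Sum>x\<in>UNIV - {0, 1}. if x \<in> X then 9 else 0)"
    by (rule sum.cong) (auto simp: P X_def)
  also have "\<dots> = (\<Sum>x\<in>X. 9)"
    by (rule sum.mono_neutral_cong_right) (auto simp: X_def)
  also have "\<dots> = 9 * of_nat (card X)"
    by simp
  finally have 1: "(\<Sum>x\<in>UNIV. P x * P (1 - x)) = 9 * of_nat (card X) + 6"
    using m by (simp add: P_def power_0_left)
  define T where "T = (\<lambda>i j. \<Sum>x\<in>UNIV. (x::'a) ^ i * (1 - x) ^ j)"
  have T: "T i j = - ((- 1) ^ (3 * m - i) * of_nat (j choose (3 * m - i)))"
    if "i \<le> 2 * m" "j \<le> 2 * m" for i j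
    unfolding T_def using that m by (intro sum_power_mult_power) auto
  have "(\<Sum>x\<in>UNIV. P x * P (1 - x)) = T 0 0 + T 0 m + T 0 (2 * m) + T m 0 + T m m + T m (2 * m)
      + T (2 * m) 0 + T (2 * m) m + T (2 * m) (2 * m)"
    unfolding P_def T_def by (simp add: algebra_simps sum.distrib)
  \<comment> \<open>Six of the nine sums vanish, as the lower index of the binomial exceeds the
    upper. \<open>T m (2 * m)\<close> and \<open>T (2 * m) m\<close> are -1, and
    \<open>T (2 * m) (2 * m)\<close> gives the central coefficient; the signs use that
    \<open>m\<close> is even.\<close>
  also have "\<dots> = - 2 - of_nat ((2 * m) choose m)"
    using m by (simp add: T binomial_eq_0)
  finally show ?thesis
    using 1 unfolding X_def[symmetric] by (simp add: eq_neg_iff_add_eq_0 algebra_simps)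
qed

section \<open>Diagonalisation of the adjacency matrix\<close>

lemma sum_const_poly: "(\<Sum>k\<in>A. [:f k:]) = [:\<Sum>k\<in>A. f k:]"
  by (induction A rule: infinite_finite_induct) auto

text \<open>The columns of \<open>V\<close> are eigenvectors, so over the polynomial ring the
  characteristic matrix times \<open>V\<close> equals \<open>V\<close> times a diagonal matrix; the
  nonzero determinant of \<open>V\<close> cancels.\<close>

lemma charpoly_eigenbasis:
  fixes A V :: "complex ^ 'n ^ 'n" and lam :: "'n \<Rightarrow> complex"
  assumes eig: "\<And>i a. (\<Sum>j\<in>UNIV. A $ i $ j * V $ j $ a) = lam a * V $ i $ a" and "det V \<noteq> 0"
  shows "charpoly A = (\<Prod>a\<in>UNIV. [:- lam a, 1:])"
proof -
  define PV :: "complex poly ^ 'n ^ 'n" where "PV = (\<chi> i j. [:V $ i $ j:])"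
  define M :: "complex poly ^ 'n ^ 'n" where "M = (\<chi> i j. (if i = j then [:0, 1:] else 0) - [:A $ i $ j:])"
  define D :: "complex poly ^ 'n ^ 'n" where "D = (\<chi> i j. if i = j then [:- lam i, 1:] else 0)"
  have "poly (det PV) 0 = det V"
    by (simp add: det_def PV_def poly_sum poly_prod)
  hence nz: "det PV \<noteq> 0"
    using assms(2) by auto
  have "M ** PV = PV ** D"
  proof (intro vec_eq_iff[THEN iffD2] allI)
    fix i a
    have "((if i = k then [:0, 1:] else 0) - [:A $ i $ k:]) * [:V $ k $ a:]
        = (if i = k then [:0, V $ i $ a:] else 0) - [:A $ i $ k * V $ k $ a:]" for k
      by (cases "i = k") (simp_all add: mult.commute)
    hence "(M ** PV) $ i $ a
        = (\<Sum>k\<in>UNIV. (if i = k then [:0, V $ i $ a:] else 0) - [:A $ i $ k * V $ k $ a:])"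
      by (simp only: matrix_matrix_mult_def M_def PV_def vec_lambda_beta)
    also have "\<dots> = [:0, V $ i $ a:] - [:lam a * V $ i $ a:]"
      by (simp add: sum_subtractf sum_const_poly eig)
    also have "\<dots> = [:V $ i $ a:] * [:- lam a, 1:]"
      by simp
    also have "\<dots> = (PV ** D) $ i $ a"
      by (simp add: matrix_matrix_mult_def D_def PV_def if_distrib[of "\<lambda>x. _ * x"] cong: if_cong)
    finally show "(M ** PV) $ i $ a = (PV ** D) $ i $ a" .
  qed
  hence "det M * det PV = det PV * det D"
    by (metis det_mul)
  hence "det M = det D"
    using nz by (simp add: mult.commute)
  also have "\<dots> = (\<Prod>a\<in>UNIV. D $ a $ a)"
    by (rule det_diagonal) (simp add: D_def)
  finally show ?thesis
    by (simp add: charpoly_def M_def D_def)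
qed

lemma proots_prod_linear:
  "proots (\<Prod>a\<in>UNIV. [:- f a, 1:]) = image_mset f (mset_set (UNIV :: 'a::finite set))"
  by (subst proots_prod) (auto simp: sum_unfold_sum_mset)

section \<open>The eigenvalues in terms of Gauss sums\<close>

context gauss_sums
begin

lemma sum_indicator3_psi:
  assumes "a \<notin> I"
  shows "(\<Sum>x\<in>S - {0}. indicator3 x * psi (a * x)) = chi2 a * G + chi a * G' - 1"
proof -
  \<comment> \<open>The dilation by \<open>a\<close> costs the inverse of \<open>f a\<close>, here
    called \<open>g a\<close>; the inverse of \<open>chi a\<close> is \<open>chi2 a\<close> and
    conversely.\<close>
  have *: "(\<Sum>x\<in>S - {0}. f x * psi (a * x)) = g a * gauss f"
    if f: "periodic f" "\<And>x y. f (x * y) = f x * f y" "\<And>x. x \<in> I \<Longrightarrow> f x = 0" and g: "g a * f a = 1"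
    for f g :: "'a \<Rightarrow> complex"
  proof -
    have "gauss f = (\<Sum>x\<in>S - {0}. f x * psi x)"
      using gauss_minus_zero[of f] f(3) by simp
    also have "\<dots> = (\<Sum>x\<in>S - {0}. f (a * x) * psi (a * x))"
      by (rule sum_scale'[OF periodic_mult[OF f(1) psi_periodic] assms, symmetric])
    finally have "g a * gauss f = (\<Sum>x\<in>S - {0}. (g a * f a) * (f x * psi (a * x)))"
      by (simp add: f(2) sum_distrib_left mult_ac)
    thus ?thesis
      by (simp add: g)
  qed
  have "(\<Sum>x\<in>S - {0}. psi (a * x)) = - 1"
    using sum_psi_mult[of a] finite_S zero_S assms
    by (simp add: sum.remove psi_zero eq_neg_iff_add_eq_0 add.commute)
  moreover have "(\<Sum>x\<in>S - {0}. chi x * psi (a * x)) = chi2 a * G"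
    by (rule *) (use assms chi_chi2[of a] in \<open>auto simp: chi_periodic chi_mult chi_I mult.commute\<close>)
  moreover have "(\<Sum>x\<in>S - {0}. chi2 x * psi (a * x)) = chi a * G'"
    by (rule *) (use assms chi_chi2[of a] in \<open>auto simp: chi2_periodic chi2_mult chi2_I\<close>)
  ultimately show ?thesis
    by (simp add: indicator3_def algebra_simps sum.distrib)
qed

lemma card_chi_scaled:
  assumes "b \<notin> I"
  shows "3 * card {x \<in> S - {0}. chi (b * x) = 1} = q - 1"
proof -
  have ind: "periodic indicator3"
    using chi_periodic chi2_periodic by (simp add: periodic_def indicator3_def)
  have "(\<Sum>x\<in>S - {0}. indicator3 (b * x)) = (\<Sum>x\<in>S - {0}. if chi (b * x) = 1 then 3 else 0)"
    using assms by (intro sum.cong refl indicator3_eq) (auto simp: I_mult_iff S_I_iff)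
  also have "\<dots> = 3 * of_nat (card {x \<in> S - {0}. chi (b * x) = 1})"
    using finite_S by (simp add: sum.If_cases Int_def)
  finally have "3 * of_nat (card {x \<in> S - {0}. chi (b * x) = 1}) = (\<Sum>x\<in>S - {0}. indicator3 x)"
    using sum_scale'[OF ind assms] by simp
  also have "\<dots> = (\<Sum>x\<in>S. indicator3 x) - 1"
    using finite_S zero_S by (simp add: sum.remove indicator3_def chi_I chi2_I zero_I)
  also have "\<dots> = of_nat (q - 1)"
    using card_S_pos by (simp add: indicator3_def sum.distrib sum_chi sum_chi2 of_nat_diff)
  finally have "of_nat (3 * card {x \<in> S - {0}. chi (b * x) = 1}) = (of_nat (q - 1) :: complex)"
    by simp
  thus ?thesis
    using of_nat_eq_iff by blast
qed

text \<open>Multiplication by \<open>nr ^ (3 - i)\<close> carries the class of value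
  \<open>cubic_root ^ i\<close> to the kernel of \<open>chi\<close>.\<close>

lemma card_chi_eq:
  assumes "i \<le> 3"
  shows "3 * card {x \<in> S - {0}. chi x = cubic_root ^ i} = q - 1"
proof -
  have "chi (nr ^ (3 - i) * x) = 1 \<longleftrightarrow> chi x = cubic_root ^ i" for x
  proof -
    have pw: "chi (nr ^ k) = cubic_root ^ k" for k
      by (induction k) (auto simp: chi_one chi_mult chi_nr)
    have *: "cubic_root ^ i * cubic_root ^ (3 - i) = 1"
      using assms cubic_root_cube by (simp flip: power_add)
    have "chi x = cubic_root ^ i * (cubic_root ^ (3 - i) * chi x)"
      using * by (simp flip: mult.assoc)
    thus ?thesis
      using * by (metis chi_mult pw mult.commute mult_1_right)
  qed
  moreover have "nr ^ (3 - i) \<notin> I"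
    using nonresidue(1) one_notin_I by (cases "3 - i = 0") (auto simp: I_power_iff)
  ultimately show ?thesis
    using card_chi_scaled[of "nr ^ (3 - i)"] by simp
qed

end

locale finite_field_gauss_sums = gauss_sums UNIV "{0 :: 'a::{field,finite}}" m nr psi
  for m :: nat and nr :: "'a::{field,finite}" and psi +
  assumes card_field: "CARD('a) = 3 * m + 1"
begin

text \<open>Cubes lie in the kernel of \<open>chi\<close>, which has \<open>m\<close> elements;
  cubing is at most three-to-one on \<open>3 * m\<close> units, so there are at least
  \<open>m\<close> cubes.\<close>

lemma power_residues_3_eq: "power_residues 3 = {x. chi x = 1}"
proof (rule card_seteq)
  show "power_residues 3 \<subseteq> {x. chi x = 1}"
    using chi_cube by (auto simp: power_residues_def power3_eq_cube chi_mult)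
  have "{x. chi x = 1} = {x \<in> UNIV - {0}. chi x = cubic_root ^ 0}"
    using chi_I[of 0] by auto
  hence 1: "card {x. chi x = 1} = m"
    using card_chi_eq[of 0] card_field by simp
  have "UNIV - {0 :: 'a} \<subseteq> (\<Union>y\<in>power_residues 3. {x. x ^ 3 = y})"
    by (auto simp: power_residues_def)
  hence "card (UNIV - {0 :: 'a}) \<le> card (\<Union>y\<in>power_residues 3. {x :: 'a. x ^ 3 = y})"
    by (intro card_mono) auto
  also have "\<dots> \<le> (\<Sum>y\<in>power_residues 3. card {x :: 'a. x ^ 3 = y})"
    by (rule card_UN_le) auto
  also have "\<dots> \<le> (\<Sum>y\<in>(power_residues 3 :: 'a set). 3)"
    by (intro sum_mono card_power_eq_le) auto
  finally have "3 * m \<le> 3 * card (power_residues 3 :: 'a set)"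
    by (simp add: card_field)
  thus "card {x. chi x = 1} \<le> card (power_residues 3 :: 'a set)"
    unfolding 1 by simp
qed auto

text \<open>The eigenvalue of the graph that belongs to the additive character sending
  \<open>x\<close> to \<open>psi (a * x)\<close>.\<close>

definition eigenvalue :: "'a \<Rightarrow> complex" where
  "eigenvalue a = (\<Sum>r\<in>power_residues 3. psi (a * r))"

lemma eigenvalue_0: "eigenvalue 0 = of_nat m"
proof -
  have "{x. chi x = 1} = {x \<in> UNIV - {0}. chi x = cubic_root ^ 0}"
    using chi_I[of 0] by auto
  hence "card {x. chi x = 1} = m"
    using card_chi_eq[of 0] card_field by simp
  thus ?thesis
    by (simp add: eigenvalue_def psi_zero power_residues_3_eq)
qed

lemma eigenvalue_nonzero:
  assumes "a \<noteq> 0"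
  shows "eigenvalue a = ((chi a)\<^sup>2 * G + chi a * G' - 1) / 3"
proof -
  have "(\<Sum>x\<in>UNIV - {0}. indicator3 x * psi (a * x)) = (\<Sum>x\<in>UNIV - {0}. if chi x = 1 then 3 * psi (a * x) else 0)"
    by (intro sum.cong) (auto simp: indicator3_eq)
  also have "\<dots> = (\<Sum>x\<in>{x. chi x = 1}. 3 * psi (a * x))"
    using chi_I[of 0] by (intro sum.mono_neutral_cong_right) auto
  also have "\<dots> = 3 * eigenvalue a"
    by (simp add: eigenvalue_def power_residues_3_eq sum_distrib_left)
  finally show ?thesis
    using sum_indicator3_psi[of a] assms by (simp add: chi2_def)
qed

lemma charpoly_cubic_paley:
  "charpoly (adjacency_matrix (generalized_paley 3 TYPE('a))) = (\<Prod>a\<in>UNIV. [:- eigenvalue a, 1:])"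
proof (rule charpoly_eigenbasis)
  define V where "V = (\<chi> x a. psi (a * x))"
  \<comment> \<open>By orthogonality of additive characters \<open>W\<close> inverts the character
    table \<open>V\<close> up to the factor \<open>CARD('a)\<close>.\<close>
  define W where "W = (\<chi> a y. psi (- (a * y)))"
  have "(V ** W) $ x $ y = (if x = y then of_nat CARD('a) else 0)" for x y
  proof -
    have "(V ** W) $ x $ y = (\<Sum>a\<in>UNIV. psi ((x - y) * a))"
      by (simp add: matrix_matrix_mult_def V_def W_def algebra_simps flip: psi_add)
    thus ?thesis
      by (simp add: sum_psi_mult)
  qed
  hence "det (V ** W) = (\<Prod>x\<in>(UNIV :: 'a set). of_nat CARD('a))"
    by (subst det_diagonal) auto
  hence "det V * det W \<noteq> 0"
    by (simp add: det_mul)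
  thus "det (\<chi> x a. psi (a * x)) \<noteq> 0"
    by (auto simp: V_def)
next
  fix x a :: 'a
  have "(\<Sum>y\<in>UNIV. adjacency_matrix (generalized_paley 3 TYPE('a)) $ x $ y * psi (a * y))
      = (\<Sum>y\<in>{y. y - x \<in> power_residues 3}. psi (a * y))"
    by (intro sum.mono_neutral_cong_right)
       (auto simp: adjacency_matrix_def generalized_paley_def cayley_digraph_def)
  also have "\<dots> = (\<Sum>r\<in>power_residues 3. psi (a * (r + x)))"
    by (rule sum.reindex_bij_witness[of _ "\<lambda>r. r + x" "\<lambda>y. y - x"]) auto
  also have "\<dots> = eigenvalue a * psi (a * x)"
    by (simp add: eigenvalue_def sum_distrib_right psi_add distrib_left)
  finally show "(\<Sum>y\<in>UNIV. adjacency_matrix (generalized_paley 3 TYPE('a)) $ x $ y * (\<chi> x a. psi (a * x)) $ y $ a)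
      = eigenvalue a * (\<chi> x a. psi (a * x)) $ x $ a"
    by simp
qed

lemma graph_spectrum_cubic_paley:
  "graph_spectrum (generalized_paley 3 TYPE('a)) =
     {#of_nat m#} + replicate_mset m ((G + G' - 1) / 3)
       + replicate_mset m ((cubic_root\<^sup>2 * G + cubic_root * G' - 1) / 3)
       + replicate_mset m ((cubic_root * G + cubic_root\<^sup>2 * G' - 1) / 3)"
proof -
  define C where "C = (\<lambda>i::nat. {x \<in> UNIV - {0 :: 'a}. chi x = cubic_root ^ i})"
  have card_C: "card (C i) = m" if "i \<le> 3" for i
    using card_chi_eq[OF that] card_field by (simp add: C_def)
  have image_C: "image_mset eigenvalue (mset_set (C i)) = replicate_mset m z"
    if "i \<le> 3" "((cubic_root ^ i)\<^sup>2 * G + cubic_root ^ i * G' - 1) / 3 = z" for i z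
  proof -
    have "image_mset eigenvalue (mset_set (C i)) = image_mset (\<lambda>_. z) (mset_set (C i))"
      using that(2) by (intro image_mset_cong) (auto simp: C_def eigenvalue_nonzero)
    thus ?thesis
      using card_C[OF that(1)] by (simp add: image_mset_const_eq)
  qed
  have neq: "cubic_root ^ 0 \<noteq> cubic_root ^ 1" "cubic_root ^ 0 \<noteq> cubic_root ^ 2"
    "cubic_root ^ 1 \<noteq> cubic_root ^ 2"
    using cubic_root_neq_1 cubic_root_square by (auto simp: cubic_root_def complex_eq_iff power2_eq_square)
  have "UNIV = {0} \<union> C 0 \<union> C 1 \<union> C 2"
  proof (intro subset_antisym subsetI)
    fix x :: 'a
    show "x \<in> {0} \<union> C 0 \<union> C 1 \<union> C 2"
    proof (cases "x = 0")
      case False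
      then obtain i where "i < 3" "chi x = cubic_root ^ i"
        using chi_cases[of x] by blast
      thus ?thesis
        using False by (auto simp: C_def less_Suc_eq numeral_3_eq_3 numeral_2_eq_2)
    qed simp
  qed simp
  hence "mset_set (UNIV :: 'a set) = mset_set ({0} \<union> C 0 \<union> C 1 \<union> C 2)"
    by simp
  also have "\<dots> = mset_set {0} + mset_set (C 0) + mset_set (C 1) + mset_set (C 2)"
    using neq by (subst mset_set_Union; (force simp: C_def)?)+
  finally have UNIV: "mset_set (UNIV :: 'a set)
      = mset_set {0} + mset_set (C 0) + mset_set (C 1) + mset_set (C 2)" .
  \<comment> \<open>Needed for the class of value \<open>cubic_root ^ 2\<close>, where the
    coefficient of \<open>G\<close> is the square of this value.\<close>
  have 4: "cubic_root ^ 4 = cubic_root"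
    using cubic_root_cube by (simp add: eval_nat_numeral)
  have "graph_spectrum (generalized_paley 3 TYPE('a)) = image_mset eigenvalue (mset_set UNIV)"
    by (simp add: graph_spectrum_def charpoly_cubic_paley proots_prod_linear)
  also have "\<dots> = {#of_nat m#} + replicate_mset m ((G + G' - 1) / 3)
       + replicate_mset m ((cubic_root\<^sup>2 * G + cubic_root * G' - 1) / 3)
       + replicate_mset m ((cubic_root * G + cubic_root\<^sup>2 * G' - 1) / 3)"
    unfolding UNIV image_mset_union by (intro arg_cong2[of _ _ _ _ "(+)"] image_C) (simp_all add: eigenvalue_0 4)
  finally show ?thesis .
qed

end

section \<open>The spectrum\<close>

text \<open>Cardano's formula read backwards: the triple of eigenvalue combinations is the root
  multiset of a cubic that involves \<open>X\<close> and \<open>Y\<close> only through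
  \<open>X * Y\<close> and \<open>X ^ 3 + Y ^ 3\<close>.\<close>

lemma proots_cubic_triple:
  "proots [:- (X ^ 3 + Y ^ 3), - 3 * (X * Y), 0, 1:]
     = {#X + Y, cubic_root\<^sup>2 * X + cubic_root * Y, cubic_root * X + cubic_root\<^sup>2 * Y#}"
proof -
  define w where "w = cubic_root"
  have w2: "w\<^sup>2 = - 1 - w"
    unfolding w_def by (rule cubic_root_square)
  let ?r = "X + Y" and ?s = "w\<^sup>2 * X + w * Y" and ?t = "w * X + w\<^sup>2 * Y"
  have sum: "?r + ?s + ?t = 0"
    unfolding w2 by (simp add: algebra_simps)
  have st: "?s * ?t = X\<^sup>2 - X * Y + Y\<^sup>2" and "?s + ?t = - (X + Y)"
  proof -
    have "?s * ?t = w ^ 3 * (X\<^sup>2 + Y\<^sup>2) + (w ^ 3 * w + w\<^sup>2) * (X * Y)"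
      by (simp add: algebra_simps power2_eq_square power3_eq_cube)
    thus "?s * ?t = X\<^sup>2 - X * Y + Y\<^sup>2"
      using cubic_root_cube by (simp add: w2 flip: w_def)
    show "?s + ?t = - (X + Y)"
      unfolding w2 by (simp add: algebra_simps)
  qed
  have pair: "?r * ?s + ?r * ?t + ?s * ?t = - 3 * (X * Y)"
  proof -
    have "?r * ?s + ?r * ?t + ?s * ?t = ?r * (?s + ?t) + ?s * ?t"
      by (simp add: algebra_simps)
    also have "\<dots> = - 3 * (X * Y)"
      unfolding st \<open>?s + ?t = _\<close> by (simp add: algebra_simps power2_eq_square)
    finally show ?thesis .
  qed
  have prod: "?r * (?s * ?t) = X ^ 3 + Y ^ 3"
    unfolding st by (simp add: algebra_simps power2_eq_square power3_eq_cube)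
  have "[:- a, 1:] * ([:- b, 1:] * [:- c, 1:])
      = [:- (a * (b * c)), a * b + a * c + b * c, - (a + b + c), 1:]" for a b c :: complex
    by (simp add: algebra_simps)
  from this[of ?r ?s ?t]
  have "[:- (X ^ 3 + Y ^ 3), - 3 * (X * Y), 0, 1:] = [:- ?r, 1:] * ([:- ?s, 1:] * [:- ?t, 1:])"
    unfolding sum pair prod by simp
  moreover have "proots ([:- a, 1:] * ([:- b, 1:] * [:- c, 1:])) = {#a, b, c#}" for a b c :: complex
    by (simp add: proots_mult del: mult_pCons_left mult_pCons_right)
  ultimately have "proots [:- (X ^ 3 + Y ^ 3), - 3 * (X * Y), 0, 1:] = {#?r, ?s, ?t#}"
    by metis
  thus ?thesis
    unfolding w_def .
qed

lemma prime_power_cong_1_mod_3: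
  fixes p :: nat
  assumes "[p = 1] (mod 3)"
  shows "p ^ f = 3 * ((p ^ f - 1) div 3) + 1"
proof -
  have "[p ^ f = 1 ^ f] (mod 3)"
    by (intro cong_pow assms)
  hence "p ^ f mod 3 = 1"
    by (simp add: cong_def)
  thus ?thesis
    by presburger
qed

context finite_field_gauss_sums
begin

text \<open>In the field the size \<open>q\<close> vanishes, so the trace reduces to minus the
  central binomial coefficient of \<open>m\<close>, which is prime to \<open>p\<close>.\<close>

lemma prime_not_dvd_jacobi_trace:
  fixes p f :: nat
  assumes p: "prime p" "[p = 1] (mod 3)" "odd p" and card: "CARD('a) = p ^ f"
  shows "\<not> int p dvd 9 * int K + 8 - int q"
proof
  assume dvd: "int p dvd 9 * int K + 8 - int q"
  have char: "CHAR('a) = p"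
    by (rule CHAR_eq_prime[OF card p(1)])
  have "K = card {x \<in> UNIV - {0, 1::'a}. x ^ m = 1 \<and> (1 - x) ^ m = 1}"
    unfolding K_def by (intro arg_cong[of _ _ card]) (auto simp: chi_eq_1_iff)
  moreover have "even m"
  proof -
    have "odd (p ^ f)"
      using p(3) by simp
    hence "odd (3 * m + 1)"
      using card card_field by metis
    thus ?thesis
      by simp
  qed
  ultimately have "(of_nat (9 * K + 8) :: 'a) = - of_nat ((2 * m) choose m)"
    using card_consecutive_cubes[of m, where ?'a = 'a] m_pos card_field by simp
  moreover have "(of_nat q :: 'a) = 0"
    using CHAR_dvd_CARD[where ?'a = 'a] by (simp add: of_nat_eq_0_iff_char_dvd)
  ultimately have "(of_int (9 * int K + 8 - int q) :: 'a) = - of_nat ((2 * m) choose m)"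
    by simp
  moreover have "(of_int (9 * int K + 8 - int q) :: 'a) = 0"
    using dvd by (simp only: of_int_eq_0_iff_char_dvd char)
  ultimately have "(of_nat ((2 * m) choose m) :: 'a) = 0"
    by simp
  hence "p dvd (2 * m) choose m"
    by (simp only: of_nat_eq_0_iff_char_dvd char)
  moreover have "m = (p ^ f - 1) div 3"
    using card card_field by simp
  moreover have "p = 3 * ((p - 1) div 3) + 1"
    using prime_power_cong_1_mod_3[OF p(2), of 1] by simp
  ultimately show False
    using prime_not_dvd_central_binomial[OF p(1), of "(p - 1) div 3" f] by simp
qed

text \<open>
  The cubic with roots \<open>3 \<lambda> + 1\<close>, for the nontrivial eigenvalues \<open>\<lambda>\<close>, depends on \<open>G\<close> and \<open>G'\<close> only
  through \<open>G * G'\<close> and \<open>G ^ 3 + G' ^ 3\<close>. Hence the ambiguity of \<open>G\<close> by a cube root of unity does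
  not matter.
\<close>

lemma graph_spectrum_eqI:
  assumes "X * Y = of_nat q" "X ^ 3 + Y ^ 3 = of_nat q * of_int (9 * int K + 8 - int q)"
  shows "graph_spectrum (generalized_paley 3 TYPE('a)) =
     {#of_nat m#} + replicate_mset m ((X + Y - 1) / 3)
       + replicate_mset m ((cubic_root\<^sup>2 * X + cubic_root * Y - 1) / 3)
       + replicate_mset m ((cubic_root * X + cubic_root\<^sup>2 * Y - 1) / 3)"
proof -
  \<comment> \<open>The nontrivial spectrum as a function of the multiset of the three values
    \<open>3 \<lambda> + 1\<close>; equality of the root multisets then suffices.\<close>
  define F where "F = (\<lambda>M. \<Sum>t\<in>#M. replicate_mset m ((t - 1) / 3 :: complex))"
  have "G ^ 3 + G' ^ 3 = of_nat q * of_int (9 * int K + 8 - int q)"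
    unfolding J_add_J'[symmetric] G_cube G'_cube by (simp add: distrib_left)
  hence "proots [:- (G ^ 3 + G' ^ 3), - 3 * (G * G'), 0, 1:] = proots [:- (X ^ 3 + Y ^ 3), - 3 * (X * Y), 0, 1:]"
    using assms G_G' by simp
  hence "F {#G + G', cubic_root\<^sup>2 * G + cubic_root * G', cubic_root * G + cubic_root\<^sup>2 * G'#}
       = F {#X + Y, cubic_root\<^sup>2 * X + cubic_root * Y, cubic_root * X + cubic_root\<^sup>2 * Y#}"
    unfolding proots_cubic_triple by simp
  thus ?thesis
    unfolding graph_spectrum_cubic_paley by (simp add: F_def add_ac)
qed

end

text \<open>The trace \<open>c\<close> is expressed through \<open>z\<close> and its conjugate, and
  \<open>graph_spectrum_eqI\<close> is applied to explicit numbers \<open>X\<close> and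
  \<open>Y\<close> in place of the Gauss sums.\<close>

theorem graph_spectrum_cubic_paley_representation:
  fixes p l :: nat and x y :: int
  assumes p: "prime p" "[p = 1] (mod 3)" and xy: "cubic_representation p x y"
    and l: "l \<ge> 1" and card: "CARD('a::{field,finite}) = p ^ (3 * l)"
  defines "n \<equiv> n_coeff p l" and "a \<equiv> a_coeff x y l" and "b \<equiv> b_coeff x y l"
  shows "graph_spectrum (generalized_paley 3 TYPE('a)) =
     {# of_nat n #}
       + replicate_mset n ((a * of_nat p ^ l - 1) / 3)
       + replicate_mset n ((- 1 / 2 * (a + 9 * b) * of_nat p ^ l - 1) / 3)
       + replicate_mset n ((- 1 / 2 * (a - 9 * b) * of_nat p ^ l - 1) / 3)"
proof -
  have p1: "p > 1"
    using p(1) by (rule prime_gt_1_nat)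
  have "p = 3 * ((p - 1) div 3) + 1"
    using prime_power_cong_1_mod_3[OF p(2), of 1] by simp
  hence "p \<noteq> 2" "p \<noteq> 3"
    by presburger+
  hence p3: "p > 3" and "odd p"
    using p1 p(1) prime_odd_nat[of p] by auto
  have card_n: "CARD('a) = 3 * n + 1"
    using prime_power_cong_1_mod_3[OF p(2), of "3 * l"] card unfolding n_def n_coeff_def by simp
  have "CARD('a) > 1"
    using one_less_power[OF p1, of "3 * l"] card l by simp
  hence n: "n > 0" "n < CARD('a) - 1" "CARD('a) - 1 = 3 * n"
    using card_n by auto
  obtain nr :: 'a where nr: "nr \<noteq> 0" "nr ^ n \<noteq> 1"
    using exists_power_neq_1[OF n(1,2)] by blast
  interpret gauss_sums UNIV "{0 :: 'a}" n nr "field_char p (3 * l)"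
    by (rule gauss_sums_finite_field[OF p(1) card _ n(3,1) nr]) (use l in simp)
  interpret finite_field_gauss_sums n nr "field_char p (3 * l)"
    by unfold_locales (rule card_n)
  define c where "c = 9 * int K + 8 - int q"
  have "[q = 1] (mod 3)"
    by (simp add: card_n cong_def)
  then obtain d where d: "4 * int q = c\<^sup>2 + 27 * d\<^sup>2"
    using card_S_quadratic_form unfolding c_def by blast
  have q: "int q = int p ^ (3 * l)"
    by (simp add: card)
  have "int q = 3 * int n + 1"
    using card_n by simp
  hence c1: "[c = 1] (mod 3)"
    unfolding c_def cong_def by presburger
  define z where "z = of_int x + of_int y * sqrt_minus_27"
  define z' where "z' = of_int x - of_int y * sqrt_minus_27"
  have pxy: "int p = x\<^sup>2 + 27 * y\<^sup>2" "[x = 1] (mod 3)"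
    using xy by (auto simp: cubic_representation_def)
  have "\<not> int p dvd c"
    unfolding c_def by (rule prime_not_dvd_jacobi_trace[OF p \<open>odd p\<close> card])
  hence c: "of_int c = - (z ^ (3 * l)) - z' ^ (3 * l)"
    unfolding z_def z'_def using d c1 l
    by (intro prime_power_quadratic_form_unique[OF p(1) p3 pxy]) (auto simp flip: q)
  have "z * z' = (of_int x)\<^sup>2 - (of_int y)\<^sup>2 * (sqrt_minus_27 * sqrt_minus_27)"
    by (simp add: z_def z'_def algebra_simps power2_eq_square)
  also have "\<dots> = of_int (int p)"
    unfolding pxy by (simp add: sqrt_minus_27_square)
  finally have zz': "z * z' = of_nat p"
    by simp
  \<comment> \<open>The numbers are forced by the two equations: with \<open>z * z' = p\<close> the
    product is \<open>p ^ (3 * l)\<close>, and the cubes add up to \<open>q\<close> times the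
    formula for \<open>c\<close>.\<close>
  define X where "X = - (of_nat p ^ l * z' ^ l)"
  define Y where "Y = - (of_nat p ^ l * z ^ l)"
  have "X * Y = of_nat p ^ l * of_nat p ^ l * (z * z') ^ l"
    by (simp add: X_def Y_def power_mult_distrib)
  also have "\<dots> = of_nat q"
    unfolding zz' card by (simp add: power_mult power3_eq_cube power_mult_distrib)
  finally have XY: "X * Y = of_nat q" .
  have "X ^ 3 + Y ^ 3 = of_nat p ^ (3 * l) * (- (z ^ (3 * l)) - z' ^ (3 * l))"
    by (simp add: X_def Y_def power_mult_distrib algebra_simps flip: power_mult)
  hence XY3: "X ^ 3 + Y ^ 3 = of_nat q * of_int c"
    by (simp add: c card)
  have s27: "sqrt_minus_27 = 3 * (of_real (sqrt 3) * \<i>)"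
    by (simp add: sqrt_minus_27_def)
  have z_eq: "of_int x + 3 * of_real (sqrt 3) * of_int y * \<i> = z"
    "of_int x - 3 * of_real (sqrt 3) * of_int y * \<i> = z'"
    by (simp_all add: z_def z'_def s27)
  have a: "a = - (z ^ l) - z' ^ l"
    unfolding a_def a_coeff_def z_eq ..
  \<comment> \<open>Each bracket in \<open>b_coeff\<close> is, up to sign, one ninth of the square
    root of -3 times \<open>z\<close> or \<open>z'\<close>, which raises the exponent from
    \<open>l - 1\<close> to \<open>l\<close>.\<close>
  have b: "9 * b = of_real (sqrt 3) * \<i> * (z ^ l - z' ^ l)"
  proof -
    have s3: "of_real (sqrt 3) * of_real (sqrt 3) = (3 :: complex)"
      by (simp flip: of_real_mult)
    have "9 * - (of_int y - of_real (sqrt 3) / 9 * of_int x * \<i>) = of_real (sqrt 3) * \<i> * z"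
      "9 * (of_int y + of_real (sqrt 3) / 9 * of_int x * \<i>) = of_real (sqrt 3) * \<i> * z'"
      unfolding z_def z'_def s27 using s3 by (simp_all add: algebra_simps)
    moreover have "9 * b = 9 * - (of_int y - of_real (sqrt 3) / 9 * of_int x * \<i>) * z ^ (l - 1)
        - 9 * (of_int y + of_real (sqrt 3) / 9 * of_int x * \<i>) * z' ^ (l - 1)"
      unfolding b_def b_coeff_def z_eq by (simp add: algebra_simps)
    ultimately have "9 * b = of_real (sqrt 3) * \<i> * z * z ^ (l - 1) - of_real (sqrt 3) * \<i> * z' * z' ^ (l - 1)"
      by simp
    also have "\<dots> = of_real (sqrt 3) * \<i> * (z * z ^ (l - 1) - z' * z' ^ (l - 1))"
      by (simp add: algebra_simps)
    finally show ?thesis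
      using l by (simp flip: power_Suc)
  qed
  have w: "cubic_root = - 1 / 2 + of_real (sqrt 3) * \<i> / 2"
    "cubic_root\<^sup>2 = - 1 / 2 - of_real (sqrt 3) * \<i> / 2"
    unfolding cubic_root_square by (simp_all add: cubic_root_def complex_eq_iff)
  have "X + Y = a * of_nat p ^ l"
    by (simp add: X_def Y_def a algebra_simps)
  moreover have "cubic_root\<^sup>2 * X + cubic_root * Y = - 1 / 2 * (a + 9 * b) * of_nat p ^ l"
    unfolding w(2) unfolding w(1) b a X_def Y_def by (simp add: field_simps)
  moreover have "cubic_root * X + cubic_root\<^sup>2 * Y = - 1 / 2 * (a - 9 * b) * of_nat p ^ l"
    unfolding w(2) unfolding w(1) b a X_def Y_def by (simp add: field_simps)
  ultimately show ?thesis
    using graph_spectrum_eqI[OF XY XY3[unfolded c_def]] by simp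
qed

text \<open>The spectrum reveals the number of vertices, and therefore the prime.\<close>

lemma size_graph_spectrum_cubic_paley:
  fixes p l :: nat
  assumes "prime p" "[p = 1] (mod 3)" "cubic_residue p 2" "l \<ge> 1"
    and "CARD('a::{field,finite}) = p ^ (3 * l)"
  shows "size (graph_spectrum (generalized_paley 3 TYPE('a))) = p ^ (3 * l)"
proof -
  obtain x y where "cubic_representation p x y"
    using exists_cubic_representation assms(1-3) by blast
  moreover have "p ^ (3 * l) = 3 * n_coeff p l + 1"
    using prime_power_cong_1_mod_3[OF assms(2), of "3 * l"] by (simp add: n_coeff_def)
  ultimately show ?thesis
    using graph_spectrum_cubic_paley_representation[OF assms(1,2) _ assms(4,5)] by simp
qed

text \<open>That one spectrum determines the other is rendered as a comparison of two admissible
  primes: equal spectra over the cubic extensions force equal spectra over the extensions of degree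
  \<open>3 * l\<close>.\<close>

theorem theorem3p4:
  fixes p :: nat
  assumes "prime p" and "[p = 1] (mod 3)" and "cubic_residue p 2"
  shows
    "(\<forall>l\<ge>1. CARD('k::{field,finite}) = p ^ 3 \<longrightarrow> CARD('l::{field,finite}) = p ^ (3 * l) \<longrightarrow>
        (\<forall>p'::nat. prime p' \<longrightarrow> [p' = 1] (mod 3) \<longrightarrow> cubic_residue p' 2 \<longrightarrow>
           CARD('m::{field,finite}) = p' ^ 3 \<longrightarrow> CARD('n::{field,finite}) = p' ^ (3 * l) \<longrightarrow>
           graph_spectrum (generalized_paley 3 TYPE('m))
             = graph_spectrum (generalized_paley 3 TYPE('k)) \<longrightarrow>
           graph_spectrum (generalized_paley 3 TYPE('n))
             = graph_spectrum (generalized_paley 3 TYPE('l))))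
     \<and> (\<exists>x\<^sub>0 y\<^sub>0 :: int. cubic_representation p x\<^sub>0 y\<^sub>0)
     \<and> (\<forall>x\<^sub>0 y\<^sub>0 :: int. cubic_representation p x\<^sub>0 y\<^sub>0 \<longrightarrow>
         (\<forall>l\<ge>1. CARD('l) = p ^ (3 * l) \<longrightarrow>
            (let n = n_coeff p l; a = a_coeff x\<^sub>0 y\<^sub>0 l; b = b_coeff x\<^sub>0 y\<^sub>0 l
             in graph_spectrum (generalized_paley 3 TYPE('l))
                  = {# of_nat n #}
                    + replicate_mset n ((a * of_nat p ^ l - 1) / 3)
                    + replicate_mset n ((- 1 / 2 * (a + 9 * b) * of_nat p ^ l - 1) / 3)
                    + replicate_mset n ((- 1 / 2 * (a - 9 * b) * of_nat p ^ l - 1) / 3))))"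
proof (intro conjI allI impI)
  fix l p' :: nat
  assume l: "l \<ge> 1" and k: "CARD('k) = p ^ 3" and l': "CARD('l) = p ^ (3 * l)"
    and p': "prime p'" "[p' = 1] (mod 3)" "cubic_residue p' 2"
    and m: "CARD('m) = p' ^ 3" and n: "CARD('n) = p' ^ (3 * l)"
    and eq: "graph_spectrum (generalized_paley 3 TYPE('m)) = graph_spectrum (generalized_paley 3 TYPE('k))"
  have "p' ^ 3 = p ^ 3"
    using size_graph_spectrum_cubic_paley[OF assms, of 1, where ?'a = 'k] k
      size_graph_spectrum_cubic_paley[OF p', of 1, where ?'a = 'm] m eq by simp
  hence "p' = p"
    by (rule power_eq_imp_eq_base) auto
  \<comment> \<open>Now that the primes agree, a single representation describes both spectra, by
    the same formula in \<open>p\<close>, \<open>l\<close>, \<open>x\<close> and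
    \<open>y\<close>.\<close>
  obtain x y where "cubic_representation p x y"
    using exists_cubic_representation[OF assms] by blast
  thus "graph_spectrum (generalized_paley 3 TYPE('n)) = graph_spectrum (generalized_paley 3 TYPE('l))"
    using graph_spectrum_cubic_paley_representation[OF assms(1,2) _ l l']
      graph_spectrum_cubic_paley_representation[OF assms(1,2) _ l n[unfolded \<open>p' = p\<close>]] by simp
next
  show "\<exists>x\<^sub>0 y\<^sub>0. cubic_representation p x\<^sub>0 y\<^sub>0"
    by (rule exists_cubic_representation[OF assms])
next
  fix x\<^sub>0 y\<^sub>0 :: int and l :: nat
  assume "cubic_representation p x\<^sub>0 y\<^sub>0" "l \<ge> 1" "CARD('l) = p ^ (3 * l)"
  thus "let n = n_coeff p l; a = a_coeff x\<^sub>0 y\<^sub>0 l; b = b_coeff x\<^sub>0 y\<^sub>0 l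
             in graph_spectrum (generalized_paley 3 TYPE('l))
                  = {# of_nat n #}
                    + replicate_mset n ((a * of_nat p ^ l - 1) / 3)
                    + replicate_mset n ((- 1 / 2 * (a + 9 * b) * of_nat p ^ l - 1) / 3)
                    + replicate_mset n ((- 1 / 2 * (a - 9 * b) * of_nat p ^ l - 1) / 3)"
    unfolding Let_def by (rule graph_spectrum_cubic_paley_representation[OF assms(1,2)])
qed

end
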